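(* For real $\alpha$, a positive integer $N$ and a real $X\ge 0$ let \[R_{\alpha}(N,X):=N^{-1}\#\{(m,n)\in\mathbb{N}^2:\ m<n\le N,\ \|\alpha(m^2-n^2)\|\le XN^{-1}\}.\] Then for almost all real $\alpha$ (with respect to Lebesgue measure) one has $R_{\alpha}(N,X)\to X$ as $N\to\infty$, for every fixed $X\ge 0$. Moreover, the set of real $\alpha$ with this property contains a dense set of constructible numbers: for every closed interval $I\subset\mathbb{R}$ of positive length there is an algorithm producing a convergent sequence of rational numbers in $I$ whose limit $\alpha\in I$ satisfies $R_{\alpha}(N,X)\to X$ as $N\to\infty$ for every fixed $X\ge 0$.
   Context: $\|t\|$ denotes the distance from the real number $t$ to the nearest integer. $\mathbb{N}=\{1,2,3,\dots\}$. *)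

theory Defs
  imports "HOL-Analysis.Analysis"
begin

definition dist_nearest_int :: "real \<Rightarrow> real" where
  "dist_nearest_int t = \<bar>t - of_int (round t)\<bar>"

definition pair_corr :: "real \<Rightarrow> nat \<Rightarrow> real \<Rightarrow> real" where
  "pair_corr \<alpha> N X =
     real (card {(m, n). 1 \<le> m \<and> m < n \<and> n \<le> N \<and>
                   dist_nearest_int (\<alpha> * ((real m)\<^sup>2 - (real n)\<^sup>2)) \<le> X / real N}) / real N"

definition pair_corr_converges :: "real \<Rightarrow> bool" where
  "pair_corr_converges \<alpha> \<longleftrightarrow> (\<forall>X\<ge>0. (\<lambda>N. pair_corr \<alpha> N X) \<longlonglongrightarrow> X)"

text \<open>
  Algorithms are programs for Kleene's partial recursive functions. Programs carry no arity;
  evaluation on an argument list is simply undefined where the list does not fit the program.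
\<close>

datatype recf =
    Zero
  | Succ
  | Proj nat
  | Comp recf "recf list"
  | PrimRec recf recf
  | Mu recf

text \<open>
  \<open>rec_eval p xs y\<close>: the program \<open>p\<close> halts on the arguments \<open>xs\<close> with result \<open>y\<close>.
  The recursion variable of \<open>PrimRec\<close> and the search variable of \<open>Mu\<close> are the first argument;
  the step program of \<open>PrimRec\<close> receives the previous index, the previous value and the parameters.
  A search by \<open>Mu\<close> halts at \<open>y\<close> only if all earlier values are defined and nonzero.
\<close>

inductive rec_eval :: "recf \<Rightarrow> nat list \<Rightarrow> nat \<Rightarrow> bool" where
  Zero: "rec_eval Zero xs 0"
| Succ: "rec_eval Succ [x] (Suc x)"
| Proj: "i < length xs \<Longrightarrow> rec_eval (Proj i) xs (xs ! i)"
| Comp: "list_all2 (\<lambda>g y. rec_eval g xs y) gs ys \<Longrightarrow> rec_eval f ys z \<Longrightarrow>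
           rec_eval (Comp f gs) xs z"
| PrimRec_0: "rec_eval f xs y \<Longrightarrow> rec_eval (PrimRec f g) (0 # xs) y"
| PrimRec_Suc: "rec_eval (PrimRec f g) (n # xs) y \<Longrightarrow> rec_eval g (n # y # xs) z \<Longrightarrow>
           rec_eval (PrimRec f g) (Suc n # xs) z"
| Mu: "rec_eval f (y # xs) 0 \<Longrightarrow> (\<And>i. i < y \<Longrightarrow> \<exists>v. rec_eval f (i # xs) (Suc v)) \<Longrightarrow>
           rec_eval (Mu f) xs y"

inductive_cases rec_eval_ZeroE: "rec_eval Zero xs y"
inductive_cases rec_eval_SuccE: "rec_eval Succ xs y"
inductive_cases rec_eval_ProjE: "rec_eval (Proj i) xs y"
inductive_cases rec_eval_CompE: "rec_eval (Comp f gs) xs y"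
inductive_cases rec_eval_PrimRec_0E: "rec_eval (PrimRec f g) (0 # xs) y"
inductive_cases rec_eval_PrimRec_SucE: "rec_eval (PrimRec f g) (Suc n # xs) y"
inductive_cases rec_eval_MuE: "rec_eval (Mu f) xs y"

lemma rec_eval_deterministic:
  "rec_eval p xs y \<Longrightarrow> rec_eval p xs y' \<Longrightarrow> y = y'"
proof (induction arbitrary: y' rule: rec_eval.induct)
  case (Zero xs)
  then show ?case by (auto elim: rec_eval_ZeroE)
next
  case (Succ x)
  then show ?case by (auto elim: rec_eval_SuccE)
next
  case (Proj i xs)
  from Proj.prems show ?case by (auto elim: rec_eval_ProjE)
next
  case (Comp xs gs ys f z)
  from Comp.prems obtain ys' where ys': "list_all2 (\<lambda>g y. rec_eval g xs y) gs ys'"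
    and z: "rec_eval f ys' y'"
    by (auto elim: rec_eval_CompE)
  have "ys = ys'"
    using Comp.IH(1) ys' by (auto simp: list_all2_conv_all_nth intro!: nth_equalityI)
  with Comp.IH(2) z show ?case by blast
next
  case (PrimRec_0 f xs y g)
  from PrimRec_0.prems PrimRec_0.IH show ?case by (auto elim: rec_eval_PrimRec_0E)
next
  case (PrimRec_Suc f g n xs y z)
  from PrimRec_Suc.prems obtain w where "rec_eval (PrimRec f g) (n # xs) w"
    "rec_eval g (n # w # xs) y'"
    by (auto elim: rec_eval_PrimRec_SucE)
  with PrimRec_Suc.IH show ?case by blast
next
  case (Mu f y xs)
  from Mu.prems have 0: "rec_eval f (y' # xs) 0"
    and less: "\<And>i. i < y' \<Longrightarrow> \<exists>v. rec_eval f (i # xs) (Suc v)"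
    by (auto elim: rec_eval_MuE)
  have "\<not> y < y'"
    using Mu.IH(1) less by (metis nat.distinct(1))
  moreover have "\<not> y' < y"
    using Mu.IH(2) 0 by (metis nat.distinct(1))
  ultimately show ?case by simp
qed

definition computable :: "(nat \<Rightarrow> nat) \<Rightarrow> bool" where
  "computable f \<longleftrightarrow> (\<exists>p. \<forall>n. rec_eval p [n] (f n))"

text \<open>
  The usual notion of a computable sequence of rationals: sign, numerator and denominator are
  total recursive functions of the index.
\<close>

definition computable_rat_seq :: "(nat \<Rightarrow> rat) \<Rightarrow> bool" where
  "computable_rat_seq q \<longleftrightarrow>
     (\<exists>s a b. computable s \<and> computable a \<and> computable b \<and>
        (\<forall>k. b k \<noteq> 0 \<and> q k = (- 1) ^ s k * of_nat (a k) / of_nat (b k)))"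

text \<open>
  A number is constructible if some algorithm produces a sequence of rationals converging to it;
  no rate of convergence is demanded.
\<close>

definition constructible :: "real \<Rightarrow> bool" where
  "constructible \<alpha> \<longleftrightarrow>
     (\<exists>q. computable_rat_seq q \<and> (\<lambda>k. real_of_rat (q k)) \<longlonglongrightarrow> \<alpha>)"

end

theory Submission
  imports Defs "HOL-Real_Asymp.Real_Asymp"
begin

text \<open>
  The variance of \<open>R(N, X)\<close> over a period is a double sum, over pairs \<open>p\<close>, \<open>q\<close> with differences of
  squares \<open>d\<close>, \<open>e\<close>, of covariances of the events \<open>\<parallel>d \<alpha>\<parallel> \<le> X / N\<close> and \<open>\<parallel>e \<alpha>\<parallel> \<le> X / N\<close>. Averaging over the
  shifts of \<open>\<alpha>\<close> by multiples of \<open>1 / e\<close> bounds such a covariance by \<open>2 (X / N) gcd(d, e) / e\<close>, and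
  since \<open>n\<^sup>2 - m\<^sup>2 = (n - m) (n + m)\<close> the sum of \<open>gcd(d, e) / e\<close> is at most \<open>4 N\<^sup>2 H(2 N)\<^sup>8\<close> with \<open>H\<close> the
  harmonic numbers. So the variance is \<open>O(X (log N)\<^sup>8 / N)\<close>; Borel--Cantelli along \<open>N = j\<^sup>8\<close> and
  interpolation, \<open>R\<close> being monotone in \<open>X\<close> and, up to rescaling, in \<open>N\<close>, give almost everywhere
  convergence.

  For the algorithm, the measures of the exceptional sets of the levels \<open>j \<ge> j\<^sub>0\<close> sum to less than the
  length of a given rational interval. The exceptional set of a level is, up to grid points, a union
  of cells of a sufficiently fine rational grid, and its membership is decided by integer arithmetic.
  The left ends of the leftmost cells that avoid the exceptional sets of the levels
  \<open>j\<^sub>0, \<dots>, k\<close> increase with \<open>k\<close>, hence converge, and the limit has the required property.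
\<close>

section \<open>Sums of greatest common divisors\<close>

lemma multiples_eq_image:
  fixes k M :: nat
  assumes "k > 0"
  shows "{s\<in>{1..M}. k dvd s} = (\<lambda>t. k * t) ` {1..M div k}"
proof (intro equalityI subsetI)
  fix s assume s: "s \<in> {s\<in>{1..M}. k dvd s}"
  then have "k dvd s" by simp
  then obtain t where t: "s = k * t" ..
  have "t \<le> M div k"
    using s t assms by (simp add: less_eq_div_iff_mult_less_eq mult.commute)
  moreover have "t \<ge> 1" using s t by (cases t) auto
  ultimately show "s \<in> (\<lambda>t. k * t) ` {1..M div k}" using t by auto
next
  fix s assume "s \<in> (\<lambda>t. k * t) ` {1..M div k}"
  then obtain t where "t \<in> {1..M div k}" and t: "s = k * t" by (rule imageE)
  then have t: "s = k * t" "t \<ge> 1" "t \<le> M div k" by simp_all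
  have "t * k \<le> M" using t(3) assms by (simp add: less_eq_div_iff_mult_less_eq)
  then show "s \<in> {s\<in>{1..M}. k dvd s}" using t(1,2) assms by (simp add: mult.commute)
qed

lemma sum_inverse_multiples_le:
  assumes "k > 0"
  shows "(\<Sum>s\<in>{s\<in>{1..M}. k dvd s}. 1 / real s) \<le> harm M / real k"
proof -
  note eq = multiples_eq_image[OF assms]
  have "(\<Sum>s\<in>{s\<in>{1..M}. k dvd s}. 1 / real s) = (\<Sum>t=1..M div k. 1 / real t) / real k"
    unfolding eq using assms
    by (subst sum.reindex) (auto simp: inj_on_def sum_divide_distrib mult.commute)
  also have "(\<Sum>t=1..M div k. 1 / real t) \<le> (\<Sum>t=1..M. 1 / real t)"
    by (rule sum_mono2) (simp_all add: div_le_dividend)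
  finally show ?thesis
    using assms by (simp add: harm_def divide_simps)
qed

text \<open>Replace gcd(s, d) by the sum of all common divisors: each divisor g of d then
  contributes g for every one of the at most M / g multiples of g, so at most M.\<close>

lemma sum_gcd_le:
  fixes d :: nat
  assumes "d > 0"
  shows "(\<Sum>s=1..M. gcd s d) \<le> M * card {g. g dvd d}"
proof -
  have fin: "finite {g. g dvd d}" using assms by simp
  have "(\<Sum>s=1..M. gcd s d) \<le> (\<Sum>s=1..M. \<Sum>g | g dvd d. if g dvd s then g else 0)"
  proof (rule sum_mono)
    fix s assume "s \<in> {1..M}"
    have "gcd s d = (\<Sum>g\<in>{gcd s d}. if g dvd s then g else 0)" by simp
    also have "\<dots> \<le> (\<Sum>g | g dvd d. if g dvd s then g else 0)"
      by (rule sum_mono2) (use fin in auto)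
    finally show "gcd s d \<le> (\<Sum>g | g dvd d. if g dvd s then g else 0)" .
  qed
  also have "\<dots> = (\<Sum>g | g dvd d. \<Sum>s=1..M. if g dvd s then g else 0)"
    by (rule sum.swap)
  also have "\<dots> \<le> (\<Sum>g | g dvd d. M)"
  proof (rule sum_mono)
    fix g assume g: "g \<in> {g. g dvd d}"
    then have "g > 0" using assms by (simp add: dvd_pos_nat)
    note eq = multiples_eq_image[OF this]
    have "(\<Sum>s=1..M. if g dvd s then g else 0) = card {s\<in>{1..M}. g dvd s} * g"
      by (simp add: sum.If_cases Int_def)
    also have "card {s\<in>{1..M}. g dvd s} \<le> M div g"
      unfolding eq using card_image_le[of "{1..M div g}" "\<lambda>t. g * t"] by simp
    also have "M div g * g \<le> M" by simp
    finally show "(\<Sum>s=1..M. if g dvd s then g else 0) \<le> M" by simp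
  qed
  finally show ?thesis by (simp add: mult.commute)
qed

text \<open>Every divisor of s t splits as a divisor of s times a divisor of t, so the products of
  such pairs exhaust the divisors of s t.\<close>

lemma card_divisors_mult_le:
  fixes s t :: nat
  assumes "s > 0" "t > 0"
  shows "card {g. g dvd s * t} \<le> card {g. g dvd s} * card {g. g dvd t}"
proof -
  have "{g. g dvd s * t} \<subseteq> (\<lambda>(x, y). x * y) ` ({g. g dvd s} \<times> {g. g dvd t})"
  proof
    fix g assume "g \<in> {g. g dvd s * t}"
    then obtain x y where "g = x * y" "x dvd s" "y dvd t"
      using division_decomp[of g s t] by auto
    then show "g \<in> (\<lambda>(x, y). x * y) ` ({g. g dvd s} \<times> {g. g dvd t})"
      by (intro image_eqI[of _ _ "(x, y)"]) simp_all
  qed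
  then have "card {g. g dvd s * t} \<le> card ({g. g dvd s} \<times> {g. g dvd t})"
    using assms by (intro surj_card_le) auto
  then show ?thesis by (simp add: card_cartesian_product)
qed

text \<open>The gcd on the left divides s t, hence factors as x y with x dividing s and y dividing
  t; both factors also divide d.\<close>

lemma gcd_mult_le:
  fixes s t d :: nat
  assumes "d > 0"
  shows "gcd (s * t) d \<le> gcd s d * gcd t d"
proof -
  obtain x y where xy: "gcd (s * t) d = x * y" "x dvd s" "y dvd t"
    using division_decomp[of "gcd (s * t) d" s t] by auto
  have "x * y dvd d" using xy(1) by (metis gcd_dvd2)
  then have "x dvd d" "y dvd d" by (auto dest: dvd_mult_left dvd_mult_right)
  with xy have "x \<le> gcd s d" "y \<le> gcd t d"
    using assms by (auto intro!: dvd_imp_le)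
  then show ?thesis unfolding xy(1) by (rule mult_le_mono)
qed

lemma inverse_lcm_eq:
  assumes "g > 0" "h > 0"
  shows "1 / real (lcm g h) = real (gcd g h) / (real g * real h)"
proof -
  have "real (gcd g h) * real (lcm g h) = real g * real h"
    by (metis of_nat_mult prod_gcd_lcm_nat)
  moreover have "lcm g h > 0" using assms by (simp add: lcm_pos_nat)
  ultimately show ?thesis using assms by (simp add: field_simps)
qed

text \<open>Since 1 / lcm(g, h) = gcd(g, h) / (g h), bound the gcd by the sum of all common divisors
  k. For fixed k the sum over g and h is a square, at most (H / k)^2 with H = \<open>harm M\<close>,
  and the weight k leaves H^2 / k.\<close>

lemma sum_inverse_lcm_le:
  "(\<Sum>g=1..M. \<Sum>h=1..M. 1 / real (lcm g h)) \<le> (harm M :: real) ^ 3"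
proof -
  let ?f = "\<lambda>k g. if k dvd g then 1 / real g else 0"
  have "(\<Sum>g=1..M. \<Sum>h=1..M. 1 / real (lcm g h))
      \<le> (\<Sum>g=1..M. \<Sum>h=1..M. \<Sum>k=1..M. real k * ?f k g * ?f k h)"
  proof (intro sum_mono)
    fix g h assume gh: "g \<in> {1..M}" "h \<in> {1..M}"
    have "gcd g h \<le> g" using gh by (intro dvd_imp_le) auto
    moreover have "gcd g h > 0" using gh by simp
    ultimately have mem: "gcd g h \<in> {1..M}" using gh by (simp del: gcd_pos_nat)
    have "1 / real (lcm g h) = (\<Sum>k\<in>{gcd g h}. real k * ?f k g * ?f k h)"
      using gh inverse_lcm_eq[of g h] by simp
    also have "\<dots> \<le> (\<Sum>k=1..M. real k * ?f k g * ?f k h)"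
      by (rule sum_mono2) (use mem in auto)
    finally show "1 / real (lcm g h) \<le> (\<Sum>k=1..M. real k * ?f k g * ?f k h)" .
  qed
  also have "\<dots> = (\<Sum>g=1..M. \<Sum>k=1..M. \<Sum>h=1..M. real k * ?f k g * ?f k h)"
    by (intro sum.cong refl sum.swap)
  also have "\<dots> = (\<Sum>k=1..M. \<Sum>g=1..M. \<Sum>h=1..M. real k * ?f k g * ?f k h)"
    by (rule sum.swap)
  also have "\<dots> = (\<Sum>k=1..M. real k * (\<Sum>g=1..M. ?f k g)\<^sup>2)"
    by (simp only: power2_eq_square sum_product) (simp only: sum_distrib_left mult.assoc)
  also have "\<dots> \<le> (\<Sum>k=1..M. real k * (harm M / real k)\<^sup>2)"
  proof (intro sum_mono mult_left_mono power_mono)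
    fix k assume k: "k \<in> {1..M}"
    have "(\<Sum>g=1..M. ?f k g) = (\<Sum>s\<in>{s\<in>{1..M}. k dvd s}. 1 / real s)"
      by (rule sum.inter_filter [symmetric]) simp
    then show "(\<Sum>g=1..M. ?f k g) \<le> harm M / real k"
      using sum_inverse_multiples_le[of k M] k by simp
  qed (auto intro!: sum_nonneg)
  also have "\<dots> = (harm M)\<^sup>2 * (\<Sum>k=1..M. 1 / real k)"
    by (simp add: sum_distrib_left power2_eq_square)
  also have "\<dots> = (harm M :: real) ^ 3"
    by (simp add: harm_def eval_nat_numeral divide_simps)
  finally show ?thesis .
qed

text \<open>The squared divisor count is the number of pairs (g, h) of divisors of s, that is, of
  pairs whose lcm divides s. Summing 1 / s over the multiples of the lcm first reduces the claim to
  \<open>sum_inverse_lcm_le\<close>.\<close>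

lemma sum_card_divisors_sq_le:
  "(\<Sum>s=1..M. (real (card {g. g dvd s}))\<^sup>2 / real s) \<le> (harm M :: real) ^ 4"
proof -
  let ?i = "\<lambda>g s::nat. if g dvd s then 1 else 0::real"
  have "(\<Sum>s=1..M. (real (card {g. g dvd s}))\<^sup>2 / real s)
      = (\<Sum>s=1..M. \<Sum>g=1..M. \<Sum>h=1..M. ?i g s * ?i h s / real s)"
  proof (rule sum.cong)
    fix s assume s: "s \<in> {1..M}"
    have "g \<in> {1..M}" if "g dvd s" for g
      using s dvd_imp_le[OF that] dvd_pos_nat[OF _ that] by simp
    then have "{1..M} \<inter> {g. g dvd s} = {g. g dvd s}" by blast
    then have "real (card {g. g dvd s}) = (\<Sum>g=1..M. ?i g s)"
      by (simp add: sum.If_cases)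
    then show "(real (card {g. g dvd s}))\<^sup>2 / real s
        = (\<Sum>g=1..M. \<Sum>h=1..M. ?i g s * ?i h s / real s)"
      by (simp only: power2_eq_square sum_product sum_divide_distrib)
  qed simp
  also have "\<dots> = (\<Sum>g=1..M. \<Sum>s=1..M. \<Sum>h=1..M. ?i g s * ?i h s / real s)"
    by (rule sum.swap)
  also have "\<dots> = (\<Sum>g=1..M. \<Sum>h=1..M. \<Sum>s=1..M. ?i g s * ?i h s / real s)"
    by (intro sum.cong refl sum.swap)
  also have "\<dots> \<le> (\<Sum>g=1..M. \<Sum>h=1..M. harm M * (1 / real (lcm g h)))"
  proof (intro sum_mono)
    fix g h assume gh: "g \<in> {1..M}" "h \<in> {1..M}"
    have "(\<Sum>s=1..M. ?i g s * ?i h s / real s)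
        = (\<Sum>s=1..M. if lcm g h dvd s then 1 / real s else 0)"
      by (intro sum.cong) auto
    also have "\<dots> = (\<Sum>s\<in>{s\<in>{1..M}. lcm g h dvd s}. 1 / real s)"
      by (rule sum.inter_filter [symmetric]) simp
    also have "\<dots> \<le> harm M / real (lcm g h)"
      by (rule sum_inverse_multiples_le) (use gh in \<open>auto simp: lcm_pos_nat\<close>)
    finally show "(\<Sum>s=1..M. ?i g s * ?i h s / real s) \<le> harm M * (1 / real (lcm g h))"
      by simp
  qed
  also have "\<dots> = harm M * (\<Sum>g=1..M. \<Sum>h=1..M. 1 / real (lcm g h))"
    by (simp only: sum_distrib_left)
  also have "\<dots> \<le> harm M * harm M ^ 3"
    by (intro mult_left_mono sum_inverse_lcm_le harm_nonneg)
  finally show ?thesis by (simp add: eval_nat_numeral)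
qed

definition ordered_pairs :: "nat \<Rightarrow> (nat \<times> nat) set" where
  "ordered_pairs N = {(m, n). 1 \<le> m \<and> m < n \<and> n \<le> N}"

definition sq_diff :: "nat \<times> nat \<Rightarrow> nat" where
  "sq_diff = (\<lambda>(m, n). n * n - m * m)"

lemma finite_ordered_pairs [simp]: "finite (ordered_pairs N)"
  by (rule finite_subset[of _ "{..N} \<times> {..N}"]) (auto simp: ordered_pairs_def)

lemma sq_diff_pos: "p \<in> ordered_pairs N \<Longrightarrow> 0 < sq_diff p"
  by (auto simp: ordered_pairs_def sq_diff_def intro!: mult_strict_mono)

lemma sq_diff_le: "p \<in> ordered_pairs N \<Longrightarrow> sq_diff p \<le> N * N"
  by (auto simp: ordered_pairs_def sq_diff_def intro!: le_trans[OF diff_le_self] mult_le_mono)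

text \<open>The substitution \<open>s = n - m\<close>, \<open>t = n + m\<close> turns sums over differences of squares into
  sums over products \<open>s t\<close>.\<close>

lemma sum_ordered_pairs_le:
  fixes F :: "nat \<Rightarrow> real"
  assumes "\<And>d. F d \<ge> 0"
  shows "(\<Sum>p\<in>ordered_pairs N. F (sq_diff p)) \<le> (\<Sum>s=1..2*N. \<Sum>t=1..2*N. F (s * t))"
proof -
  let ?h = "\<lambda>(m, n). (n - m, n + m :: nat)"
  have inj: "inj_on ?h (ordered_pairs N)"
    by (auto simp: inj_on_def ordered_pairs_def)
  have "(\<Sum>p\<in>ordered_pairs N. F (sq_diff p)) = (\<Sum>p\<in>ordered_pairs N. (\<lambda>(s, t). F (s * t)) (?h p))"
  proof (intro sum.cong refl)
    fix p assume "p \<in> ordered_pairs N"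
    then obtain m n where p: "p = (m, n)" "m < n" by (auto simp: ordered_pairs_def)
    obtain k where "n = m + k" using p(2) less_imp_add_positive by blast
    then have "n * n - m * m = (n - m) * (n + m)" by (simp add: algebra_simps)
    then show "F (sq_diff p) = (\<lambda>(s, t). F (s * t)) (?h p)"
      by (simp add: p sq_diff_def)
  qed
  also have "\<dots> = (\<Sum>(s, t)\<in>?h ` ordered_pairs N. F (s * t))"
    by (subst sum.reindex[OF inj]) simp
  also have "\<dots> \<le> (\<Sum>(s, t)\<in>{1..2*N} \<times> {1..2*N}. F (s * t))"
    by (rule sum_mono2) (auto simp: ordered_pairs_def assms)
  also have "\<dots> = (\<Sum>s=1..2*N. \<Sum>t=1..2*N. F (s * t))"
    by (rule sum.cartesian_product [symmetric])
  finally show ?thesis .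
qed

text \<open>After the substitution by products s t, \<open>gcd_mult_le\<close> turns the double sum
  into the square of the sum in \<open>sum_gcd_le\<close>.\<close>

lemma sum_gcd_sq_diff_le:
  assumes "d > 0"
  shows "(\<Sum>p\<in>ordered_pairs N. real (gcd (sq_diff p) d)) \<le> (2 * real N * card {g. g dvd d})\<^sup>2"
proof -
  have "(\<Sum>p\<in>ordered_pairs N. real (gcd (sq_diff p) d))
      \<le> (\<Sum>s=1..2*N. \<Sum>t=1..2*N. real (gcd (s * t) d))"
    by (rule sum_ordered_pairs_le) simp
  also have "\<dots> \<le> (\<Sum>s=1..2*N. \<Sum>t=1..2*N. real (gcd s d) * real (gcd t d))"
    using gcd_mult_le[OF assms] by (intro sum_mono) (metis of_nat_le_iff of_nat_mult)
  also have "\<dots> = (real (\<Sum>s=1..2*N. gcd s d))\<^sup>2"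
    by (simp only: power2_eq_square sum_product of_nat_sum)
  also have "\<dots> \<le> (2 * real N * card {g. g dvd d})\<^sup>2"
  proof (rule power_mono)
    have "real (\<Sum>s=1..2*N. gcd s d) \<le> real (2 * N * card {g. g dvd d})"
      using sum_gcd_le[OF assms] by (simp only: of_nat_le_iff)
    then show "real (\<Sum>s=1..2*N. gcd s d) \<le> 2 * real N * card {g. g dvd d}" by simp
  qed (rule of_nat_0_le_iff)
  finally show ?thesis .
qed

text \<open>The inner sum costs the squared divisor count of the outer difference. A second passage
  to products s t and submultiplicativity of the divisor count again produce a square, now of the
  sum in \<open>sum_card_divisors_sq_le\<close>.\<close>

lemma sum_gcd_div_sq_diff_le:
  "(\<Sum>q\<in>ordered_pairs N. \<Sum>p\<in>ordered_pairs N. real (gcd (sq_diff p) (sq_diff q)) / real (sq_diff q))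
    \<le> 4 * (real N)\<^sup>2 * harm (2 * N) ^ 8"
proof -
  let ?t = "\<lambda>d::nat. (real (card {g. g dvd d}))\<^sup>2 / real d"
  have "(\<Sum>q\<in>ordered_pairs N. \<Sum>p\<in>ordered_pairs N. real (gcd (sq_diff p) (sq_diff q)) / real (sq_diff q))
      \<le> (\<Sum>q\<in>ordered_pairs N. 4 * (real N)\<^sup>2 * ?t (sq_diff q))"
  proof (intro sum_mono)
    fix q assume q: "q \<in> ordered_pairs N"
    have "(\<Sum>p\<in>ordered_pairs N. real (gcd (sq_diff p) (sq_diff q)) / real (sq_diff q))
        = (\<Sum>p\<in>ordered_pairs N. real (gcd (sq_diff p) (sq_diff q))) / real (sq_diff q)"
      by (simp only: sum_divide_distrib)
    also have "\<dots> \<le> (2 * real N * card {g. g dvd sq_diff q})\<^sup>2 / real (sq_diff q)"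
      by (intro divide_right_mono sum_gcd_sq_diff_le sq_diff_pos[OF q]) simp
    finally show "(\<Sum>p\<in>ordered_pairs N. real (gcd (sq_diff p) (sq_diff q)) / real (sq_diff q))
        \<le> 4 * (real N)\<^sup>2 * ?t (sq_diff q)" by (simp add: power_mult_distrib)
  qed
  also have "\<dots> = 4 * (real N)\<^sup>2 * (\<Sum>q\<in>ordered_pairs N. ?t (sq_diff q))"
    by (simp only: sum_distrib_left)
  also have "(\<Sum>q\<in>ordered_pairs N. ?t (sq_diff q)) \<le> (\<Sum>s=1..2*N. \<Sum>t=1..2*N. ?t (s * t))"
    by (rule sum_ordered_pairs_le) simp
  also have "\<dots> \<le> (\<Sum>s=1..2*N. \<Sum>t=1..2*N. ?t s * ?t t)"
  proof (intro sum_mono)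
    fix s t assume st: "s \<in> {1..2*N}" "t \<in> {1..2*N}"
    have "real (card {g. g dvd s * t}) \<le> real (card {g. g dvd s} * card {g. g dvd t})"
      using card_divisors_mult_le[of s t] st by (simp only: of_nat_le_iff) simp
    then have "(real (card {g. g dvd s * t}))\<^sup>2 \<le> (real (card {g. g dvd s} * card {g. g dvd t}))\<^sup>2"
      by (rule power_mono) simp
    then have "?t (s * t) \<le> (real (card {g. g dvd s} * card {g. g dvd t}))\<^sup>2 / real (s * t)"
      by (rule divide_right_mono) simp
    then show "?t (s * t) \<le> ?t s * ?t t" by (simp add: power_mult_distrib)
  qed
  also have "\<dots> = (\<Sum>s=1..2*N. ?t s)\<^sup>2"
    by (simp only: power2_eq_square sum_product)
  also have "\<dots> \<le> (harm (2 * N) ^ 4)\<^sup>2"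
    by (intro power_mono sum_card_divisors_sq_le sum_nonneg) simp
  also have "\<dots> = harm (2 * N) ^ 8" by (simp flip: power_mult)
  finally show ?thesis by (simp add: mult_left_mono)
qed

section \<open>The variance of the pair correlation\<close>

lemma dist_nearest_int_le_iff:
  "dist_nearest_int t \<le> \<delta> \<longleftrightarrow> (\<exists>z::int. \<bar>t - of_int z\<bar> \<le> \<delta>)"
proof
  assume "dist_nearest_int t \<le> \<delta>"
  then show "\<exists>z::int. \<bar>t - of_int z\<bar> \<le> \<delta>" by (auto simp: dist_nearest_int_def)
next
  assume "\<exists>z::int. \<bar>t - of_int z\<bar> \<le> \<delta>"
  then obtain z :: int where z: "\<bar>t - of_int z\<bar> \<le> \<delta>" ..
  have "\<bar>t - of_int (round t)\<bar> \<le> \<bar>t - of_int z\<bar>"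
    using round_diff_minimal[of t z] by simp
  with z show "dist_nearest_int t \<le> \<delta>" by (simp add: dist_nearest_int_def)
qed

lemma dist_nearest_int_minus [simp]: "dist_nearest_int (- t) = dist_nearest_int t"
proof -
  have "dist_nearest_int (- t) \<le> dist_nearest_int t" for t
  proof -
    have "\<bar>- t - of_int (- round t)\<bar> \<le> dist_nearest_int t"
      by (simp add: dist_nearest_int_def)
    then show ?thesis unfolding dist_nearest_int_le_iff by blast
  qed
  from this[of t] this[of "- t"] show ?thesis by simp
qed

lemma dist_nearest_int_add_of_int [simp]:
  "dist_nearest_int (t + of_int k) = dist_nearest_int t"
proof -
  have *: "dist_nearest_int (t + of_int k) \<le> dist_nearest_int t" for t and k :: int
  proof -
    have "\<bar>t + of_int k - of_int (round t + k)\<bar> \<le> dist_nearest_int t"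
      by (simp add: dist_nearest_int_def)
    then show ?thesis unfolding dist_nearest_int_le_iff by blast
  qed
  from *[of t k] *[of "t + of_int k" "- k"] show ?thesis by simp
qed

lemma dist_nearest_int_add_of_nat [simp]:
  "dist_nearest_int (t + of_nat k) = dist_nearest_int t"
  using dist_nearest_int_add_of_int[of t "int k"] by simp

lemma dist_nearest_int_measurable [measurable]: "dist_nearest_int \<in> borel_measurable borel"
  unfolding dist_nearest_int_def round_def by measurable

lemma dist_nearest_int_add_le:
  "dist_nearest_int (t + h) \<le> dist_nearest_int t + \<bar>h\<bar>"
proof -
  have "\<bar>t + h - of_int (round t)\<bar> \<le> dist_nearest_int t + \<bar>h\<bar>"
    by (simp add: dist_nearest_int_def)
  then show ?thesis unfolding dist_nearest_int_le_iff by blast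
qed

section \<open>Lebesgue measure on one period, under shifts and dilations\<close>

definition unit_unif :: "real measure" where
  "unit_unif = density lborel (indicator {0..<1})"

lemma sets_unit_unif [simp, measurable_cong]: "sets unit_unif = sets borel"
  by (simp add: unit_unif_def)

lemma space_unit_unif [simp]: "space unit_unif = UNIV"
  by (simp add: unit_unif_def)

lemma emeasure_unit_unif:
  "A \<in> sets borel \<Longrightarrow> emeasure unit_unif A = emeasure lborel ({0..<1} \<inter> A)"
  by (simp add: unit_unif_def emeasure_restricted)

lemma measure_unit_unif:
  "A \<in> sets borel \<Longrightarrow> measure unit_unif A = measure lborel ({0..<1} \<inter> A)"
  by (simp add: measure_def emeasure_unit_unif)

interpretation unit_unif: finite_measure unit_unif
  by standard (simp add: emeasure_unit_unif)

lemma measure_unit_unif_UNIV [simp]: "measure unit_unif UNIV = 1"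
  by (simp add: measure_unit_unif)

lemma emeasure_lborel_translate:
  fixes A :: "real set"
  assumes [measurable]: "A \<in> sets borel"
  shows "emeasure lborel {x. c + x \<in> A} = emeasure lborel A"
proof -
  have "emeasure lborel A = emeasure (distr lborel borel ((+) c)) A"
    by (simp add: lborel_distr_plus)
  also have "\<dots> = emeasure lborel {x. c + x \<in> A}"
    by (subst emeasure_distr) (auto simp: vimage_def)
  finally show ?thesis ..
qed

lemma emeasure_lborel_scale:
  fixes A :: "real set"
  assumes [measurable]: "A \<in> sets borel" and "c > 0"
  shows "emeasure lborel {x. c * x \<in> A} = ennreal (inverse c) * emeasure lborel A"
proof -
  have "emeasure lborel {x. c * x \<in> A} = emeasure (distr lborel borel ((*) c)) A"
    by (subst emeasure_distr) (auto simp: vimage_def)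
  also have "\<dots> = ennreal (inverse c) * emeasure lborel A"
    using assms(2) by (simp add: lborel_distr_mult emeasure_density nn_integral_cmult_indicator)
  finally show ?thesis .
qed

lemma emeasure_periodic_interval:
  fixes S :: "real set" and k :: int
  assumes [measurable]: "S \<in> sets borel" and per: "\<And>x. x + 1 \<in> S \<longleftrightarrow> x \<in> S"
  shows "emeasure lborel ({of_int k..<of_int k + 1} \<inter> S) = emeasure lborel ({0..<1} \<inter> S)"
proof -
  have nat: "x + of_nat n \<in> S \<longleftrightarrow> x \<in> S" for x n
  proof (induction n)
    case (Suc n)
    then show ?case using per[of "x + of_nat n"] by (simp add: ac_simps)
  qed simp
  have int: "x + of_int m \<in> S \<longleftrightarrow> x \<in> S" for x and m :: int
  proof (cases "m \<ge> 0")
    case True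
    then show ?thesis using nat[of x "nat m"] by simp
  next
    case False
    then show ?thesis using nat[of "x + of_int m" "nat (- m)"] by simp
  qed
  have "{0..<1} \<inter> S = {x. of_int k + x \<in> {of_int k..<of_int k + 1} \<inter> S}"
    using int[of _ k] by (auto simp: add.commute)
  then show ?thesis
    using emeasure_lborel_translate[of "{of_int k..<of_int k + 1} \<inter> S" "of_int k"] by simp
qed

text \<open>The window [t, 1 + t) is cut at 1, and periodicity carries the overhang [1, 1 + t) back
  to [0, t).\<close>

lemma emeasure_unit_unif_shift:
  fixes S :: "real set"
  assumes [measurable]: "S \<in> sets borel" and per: "\<And>x. x + 1 \<in> S \<longleftrightarrow> x \<in> S"
    and t: "0 \<le> t" "t \<le> 1"
  shows "emeasure unit_unif {x. x + t \<in> S} = emeasure unit_unif S"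
proof -
  have [measurable]: "{x. x + t \<in> S} \<in> sets borel" by measurable
  have T: "{0..<1} \<inter> {x. x + t \<in> S} = {x. t + x \<in> {t..<1} \<inter> S} \<union> {x. t + x \<in> {1..<1 + t} \<inter> S}"
    using t by (auto simp: add.commute)
  have U: "{1..<1 + t} \<inter> S = {x. - 1 + x \<in> {0..<t} \<inter> S}"
    using per[of "_ - 1"] by auto
  have "emeasure unit_unif {x. x + t \<in> S} = emeasure lborel ({0..<1} \<inter> {x. x + t \<in> S})"
    by (rule emeasure_unit_unif) measurable
  also have "\<dots> = emeasure lborel {x. t + x \<in> {t..<1} \<inter> S} + emeasure lborel {x. t + x \<in> {1..<1 + t} \<inter> S}"
    unfolding T by (rule plus_emeasure [symmetric]) (auto simp: sets_borel_eq_count_space)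
  also have "\<dots> = emeasure lborel ({t..<1} \<inter> S) + emeasure lborel ({1..<1 + t} \<inter> S)"
    by (subst (1 2) emeasure_lborel_translate) auto
  also have "emeasure lborel ({1..<1 + t} \<inter> S) = emeasure lborel ({0..<t} \<inter> S)"
    unfolding U by (rule emeasure_lborel_translate) auto
  also have "emeasure lborel ({t..<1} \<inter> S) + emeasure lborel ({0..<t} \<inter> S)
      = emeasure lborel (({t..<1} \<inter> S) \<union> ({0..<t} \<inter> S))"
    by (rule plus_emeasure) auto
  also have "({t..<1} \<inter> S) \<union> ({0..<t} \<inter> S) = {0..<1} \<inter> S" using t by auto
  finally show ?thesis by (simp add: emeasure_unit_unif)
qed

text \<open>Dilation by d stretches [0, 1) over d full periods, and the scaling factor 1 / d
  compensates for their number.\<close>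

lemma emeasure_unit_unif_dilate:
  fixes S :: "real set"
  assumes [measurable]: "S \<in> sets borel" and per: "\<And>x. x + 1 \<in> S \<longleftrightarrow> x \<in> S" and d: "d > 0"
  shows "emeasure unit_unif {x. real d * x \<in> S} = emeasure unit_unif S"
proof -
  have *: "emeasure lborel ({0..<real n} \<inter> S) = of_nat n * emeasure lborel ({0..<1} \<inter> S)" for n
  proof (induction n)
    case (Suc n)
    have "{0..<real (Suc n)} \<inter> S = ({0..<real n} \<inter> S) \<union> ({real n..<real n + 1} \<inter> S)"
      by auto
    then have "emeasure lborel ({0..<real (Suc n)} \<inter> S)
        = emeasure lborel ({0..<real n} \<inter> S) + emeasure lborel ({real n..<real n + 1} \<inter> S)"
      by (simp add: plus_emeasure del: of_nat_Suc) (subst plus_emeasure; auto)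
    also have "emeasure lborel ({real n..<real n + 1} \<inter> S) = emeasure lborel ({0..<1} \<inter> S)"
      using emeasure_periodic_interval[OF assms(1) per, of "int n"] by simp
    finally show ?case using Suc by (simp add: distrib_right add.commute)
  qed simp
  have eq: "{0..<1} \<inter> {x. real d * x \<in> S} = {x. real d * x \<in> {0..<real d} \<inter> S}"
    using d by (auto simp: zero_le_mult_iff)
  have "emeasure unit_unif {x. real d * x \<in> S} = emeasure lborel {x. real d * x \<in> {0..<real d} \<inter> S}"
    unfolding eq [symmetric] by (rule emeasure_unit_unif) measurable
  also have "\<dots> = ennreal (inverse (real d)) * (of_nat d * emeasure lborel ({0..<1} \<inter> S))"
    using d by (subst emeasure_lborel_scale) (auto simp: *)
  also have "\<dots> = emeasure lborel ({0..<1} \<inter> S)"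
    using d by (simp add: ennreal_of_nat_eq_real_of_nat mult.assoc [symmetric] flip: ennreal_mult)
  finally show ?thesis by (simp add: emeasure_unit_unif)
qed

section \<open>Measures and correlations of near-integer events\<close>

lemma measure_near_int:
  assumes "0 \<le> \<delta>" "\<delta> < 1 / 2"
  shows "measure unit_unif {x. dist_nearest_int x \<le> \<delta>} = 2 * \<delta>"
proof -
  \<comment> \<open>Only the integers 0 and 1 come within \<delta> of a point of [0, 1), and
    \<delta> < 1 / 2 keeps the two pieces disjoint.\<close>
  have eq: "{0..<1} \<inter> {x. dist_nearest_int x \<le> \<delta>} = {0..\<delta>} \<union> {1 - \<delta>..<1}"
  proof (intro equalityI subsetI)
    fix x assume "x \<in> {0..<1} \<inter> {x. dist_nearest_int x \<le> \<delta>}"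
    then obtain z :: int where x: "0 \<le> x" "x < 1" and z: "\<bar>x - of_int z\<bar> \<le> \<delta>"
      by (auto simp: dist_nearest_int_le_iff)
    have "-1 < real_of_int z" "real_of_int z < 2" using x z assms by linarith+
    then have "z = 0 \<or> z = 1" by linarith
    then show "x \<in> {0..\<delta>} \<union> {1 - \<delta>..<1}" using x z by auto
  next
    fix x assume "x \<in> {0..\<delta>} \<union> {1 - \<delta>..<1}"
    then have "(0 \<le> x \<and> x < 1) \<and> (\<bar>x - of_int 0\<bar> \<le> \<delta> \<or> \<bar>x - of_int 1\<bar> \<le> \<delta>)"
      using assms by auto
    then show "x \<in> {0..<1} \<inter> {x. dist_nearest_int x \<le> \<delta>}"
      unfolding dist_nearest_int_le_iff atLeastLessThan_iff Int_iff mem_Collect_eq by blast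
  qed
  have "measure unit_unif {x. dist_nearest_int x \<le> \<delta>} = measure lborel ({0..\<delta>} \<union> {1 - \<delta>..<1})"
    unfolding eq [symmetric] by (rule measure_unit_unif) measurable
  also have "\<dots> = measure lborel {0..\<delta>} + measure lborel {1 - \<delta>..<1}"
    using assms by (intro measure_Union) auto
  finally show ?thesis using assms by simp
qed

lemma measure_near_int_dilate:
  assumes "0 \<le> \<delta>" "\<delta> < 1 / 2" "d > 0"
  shows "measure unit_unif {x. dist_nearest_int (real d * x) \<le> \<delta>} = 2 * \<delta>"
proof -
  have per: "x + 1 \<in> {x. dist_nearest_int x \<le> \<delta>} \<longleftrightarrow> x \<in> {x. dist_nearest_int x \<le> \<delta>}" for x
    using dist_nearest_int_add_of_int[of x 1] by simp
  have "{x. dist_nearest_int x \<le> \<delta>} \<in> sets borel" by measurable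
  from emeasure_unit_unif_dilate[OF this per assms(3)] measure_near_int[OF assms(1,2)]
  show ?thesis by (simp add: measure_def)
qed

text \<open>As \<open>j\<close> runs through the residues modulo \<open>b\<close>, so does \<open>a j\<close>; hence the points counted
  here correspond to distinct integers in an interval of length \<open>2 \<delta> b\<close>.\<close>

lemma card_near_int_progression_le:
  assumes "coprime a b" "b > 0" "\<delta> \<ge> 0"
  shows "real (card {j\<in>{..<b}. dist_nearest_int (y + real a * real j / real b) \<le> \<delta>})
    \<le> 2 * \<delta> * real b + 1"
proof -
  let ?J = "{j\<in>{..<b}. dist_nearest_int (y + real a * real j / real b) \<le> \<delta>}"
  \<comment> \<open>\<open>w j\<close> is the representative of a j modulo b for which y b +
    \<open>w j\<close> is b times the signed distance to the nearest integer; a small distance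
    confines it to an interval of length 2 \<delta> b.\<close>
  define w where "w j = int (a * j) - round (y + real a * real j / real b) * int b" for j
  let ?l = "\<lceil>- y * real b - \<delta> * real b\<rceil>" and ?u = "\<lfloor>- y * real b + \<delta> * real b\<rfloor>"
  have "w ` ?J \<subseteq> {?l..?u}"
  proof
    fix v assume "v \<in> w ` ?J"
    then obtain j where j: "v = w j" "dist_nearest_int (y + real a * real j / real b) \<le> \<delta>" by auto
    have "y * real b + of_int v
        = (y + real a * real j / real b - of_int (round (y + real a * real j / real b))) * real b"
      using assms(2) by (simp add: j(1) w_def field_simps)
    then have "\<bar>y * real b + of_int v\<bar> \<le> \<delta> * real b"
      using j(2) by (simp add: dist_nearest_int_def abs_mult mult_right_mono)
    then have "- y * real b - \<delta> * real b \<le> of_int v" "of_int v \<le> - y * real b + \<delta> * real b"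
      by linarith+
    then show "v \<in> {?l..?u}" by (simp only: atLeastAtMost_iff ceiling_le_iff le_floor_iff)
  qed
  moreover have "inj_on w ?J"
  proof (rule inj_onI)
    fix i j assume ij: "i \<in> ?J" "j \<in> ?J" "w i = w j"
    define r where "r k = round (y + real a * real k / real b)" for k
    have "int a * (int i - int j) = int b * (r i - r j)"
      using ij(3) by (simp add: w_def flip: r_def) (simp add: algebra_simps)
    then have "int b dvd int a * (int i - int j)" by simp
    moreover have "coprime (int b) (int a)" using assms(1) by (simp add: coprime_commute)
    ultimately have "int b dvd int i - int j" by (simp add: coprime_dvd_mult_right_iff)
    moreover have "i < b" "j < b" using ij(1,2) by simp_all
    then have "\<bar>int i - int j\<bar> < int b" by linarith
    ultimately have "int i - int j = 0" using dvd_imp_le_int[of "int i - int j" "int b"] by force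
    then show "i = j" by simp
  qed
  ultimately have "card ?J \<le> card {?l..?u}"
    using card_inj_on_le by blast
  then have "real (card ?J) \<le> real (nat (?u - ?l + 1))" by simp
  also have "\<dots> \<le> 2 * \<delta> * real b + 1"
  \<comment> \<open>If the difference is negative, \<open>nat\<close> truncates it to 0 and the
    bound holds because its right side is positive.\<close>
  proof (cases "?u - ?l + 1 \<ge> 0")
    case True
    then have "real (nat (?u - ?l + 1)) = of_int ?u - of_int ?l + 1" by simp
    also have "\<dots> \<le> (- y * real b + \<delta> * real b) - (- y * real b - \<delta> * real b) + 1"
      by (intro add_right_mono diff_mono of_int_floor_le le_of_int_ceiling)
    finally show ?thesis by simp
  qed (use assms in simp)
  finally show ?thesis .
qed

text \<open>Shifting x by j / e keeps the condition on e x and adds a j / b to d x, where a / b is d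
  / e in lowest terms. At a point of the second event at most 2 \<delta> b + 1 of the b shifted
  first events occur, so the average over j < b gives 2 \<delta> (2 \<delta> + 1 / b), and 1 / b =
  gcd(d, e) / e.\<close>

lemma measure_near_int_pair_le:
  fixes d e :: nat
  assumes \<delta>: "0 \<le> \<delta>" "\<delta> < 1 / 2" and "d > 0" "e > 0"
  shows "measure unit_unif {x. dist_nearest_int (real d * x) \<le> \<delta> \<and> dist_nearest_int (real e * x) \<le> \<delta>}
    \<le> (2 * \<delta>)\<^sup>2 + 2 * \<delta> * (real (gcd d e) / real e)"
proof -
  define g where "g = gcd d e"
  obtain a b where ab: "d = a * g" "e = b * g" "coprime a b"
    using gcd_coprime_exists[of d e] assms(3) unfolding g_def by auto
  have b: "b > 0" and g: "g > 0" using ab assms by auto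
  let ?S = "\<lambda>j. {x. dist_nearest_int (real d * x + real a * real j / real b) \<le> \<delta>
    \<and> dist_nearest_int (real e * x) \<le> \<delta>}"
  let ?E = "{x. dist_nearest_int (real e * x) \<le> \<delta>}"
  have [measurable]: "?S j \<in> sets borel" "?E \<in> sets borel" for j by measurable
  \<comment> \<open>The shift by j / e adds the integer j to e x; j < b \<le> e keeps it within one
    period.\<close>
  have S: "measure unit_unif (?S j) = measure unit_unif (?S 0)" if "j < b" for j
  proof -
    have "?S j = {x. x + real j / real e \<in> ?S 0}"
    proof -
      have "real d * (x + real j / real e) = real d * x + real a * real j / real b"
        "real e * (x + real j / real e) = real e * x + of_nat j" for x
        using b g by (simp_all add: ab field_simps)
      then show ?thesis by simp
    qed
    moreover have "x + 1 \<in> ?S 0 \<longleftrightarrow> x \<in> ?S 0" for x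
      by (simp add: distrib_left)
    moreover have "real j / real e \<le> 1" using that g assms(4) ab(2)
      by (simp add: divide_le_eq) (metis One_nat_def Suc_leI le_trans less_imp_le mult.right_neutral mult_le_mono2 of_nat_le_iff of_nat_mult)
    ultimately show ?thesis
      using emeasure_unit_unif_shift[of "?S 0" "real j / real e"] by (simp add: measure_def)
  qed
  have "real b * measure unit_unif (?S 0) = (\<Sum>j<b. measure unit_unif (?S j))"
    using S by simp
  also have "\<dots> = (\<integral>x. (\<Sum>j<b. indicator (?S j) x) \<partial>unit_unif)"
    by (subst Bochner_Integration.integral_sum) (auto simp: integrable_indicator_iff unit_unif.emeasure_finite less_top[symmetric])
  \<comment> \<open>Pointwise: off \<open>?E\<close> all indicators vanish, and on \<open>?E\<close>
    their sum is the count bounded by \<open>card_near_int_progression_le\<close>.\<close>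
  also have "\<dots> \<le> (\<integral>x. (2 * \<delta> * real b + 1) * indicator ?E x \<partial>unit_unif)"
  proof (rule integral_mono)
    fix x
    have "(\<Sum>j<b. indicator (?S j) x :: real)
        = indicator ?E x * real (card {j\<in>{..<b}. dist_nearest_int (real d * x + real a * real j / real b) \<le> \<delta>})"
      by (auto simp: indicator_def sum.If_cases Int_def)
    also have "\<dots> \<le> indicator ?E x * (2 * \<delta> * real b + 1)"
      by (intro mult_left_mono card_near_int_progression_le ab b \<delta>) simp
    finally show "(\<Sum>j<b. indicator (?S j) x) \<le> (2 * \<delta> * real b + 1) * indicator ?E x"
      by (simp add: mult.commute)
  qed (auto intro!: Bochner_Integration.integrable_sum simp: integrable_indicator_iff unit_unif.emeasure_finite less_top[symmetric])
  also have "\<dots> = (2 * \<delta> * real b + 1) * (2 * \<delta>)"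
    using measure_near_int_dilate[OF \<delta> assms(4)] by simp
  finally have "measure unit_unif (?S 0) \<le> (2 * \<delta> * real b + 1) * (2 * \<delta>) / real b"
    using b by (simp add: field_simps)
  also have "\<dots> = (2 * \<delta>)\<^sup>2 + 2 * \<delta> * (1 / real b)"
    using b by (simp add: field_simps power2_eq_square)
  also have "1 / real b = real g / real e" using b g by (simp add: ab)
  finally show ?thesis by (simp add: g_def)
qed

section \<open>Mean and variance of the pair correlation\<close>

lemma pair_corr_eq_sum:
  "pair_corr x N X = (\<Sum>p\<in>ordered_pairs N.
     indicator {x. dist_nearest_int (real (sq_diff p) * x) \<le> X / real N} x) / real N"
proof -
  have "{(m, n). 1 \<le> m \<and> m < n \<and> n \<le> N \<and> dist_nearest_int (x * ((real m)\<^sup>2 - (real n)\<^sup>2)) \<le> X / real N}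
      = {p\<in>ordered_pairs N. dist_nearest_int (real (sq_diff p) * x) \<le> X / real N}"
  proof -
    \<comment> \<open>For m < n the difference m^2 - n^2 is negative; as the distance is even, the
      natural number \<open>sq_diff\<close> can replace it.\<close>
    have "real (sq_diff (m, n)) * x = - (x * ((real m)\<^sup>2 - (real n)\<^sup>2))" if "m < n" for m n
      using that by (simp add: sq_diff_def of_nat_diff mult_le_mono power2_eq_square algebra_simps)
    then show ?thesis by (auto simp: ordered_pairs_def)
  qed
  then show ?thesis
    by (simp add: pair_corr_def indicator_def sum.If_cases Int_def)
qed

lemma pair_corr_measurable [measurable]: "(\<lambda>x. pair_corr x N X) \<in> borel_measurable borel"
  unfolding pair_corr_eq_sum by measurable

lemma pair_corr_add_of_int [simp]: "pair_corr (x + of_int k) N X = pair_corr x N X"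
proof -
  have "real d * (x + of_int k) = real d * x + of_int (int d * k)" for d
    by (simp add: algebra_simps)
  then have "dist_nearest_int (real d * (x + of_int k)) = dist_nearest_int (real d * x)" for d
    by (simp only: dist_nearest_int_add_of_int)
  then show ?thesis by (simp add: pair_corr_eq_sum indicator_def)
qed

lemma card_ordered_pairs: "2 * card (ordered_pairs N) = N * (N - 1)"
proof (induction N)
  case 0
  have "ordered_pairs 0 = {}" by (auto simp: ordered_pairs_def)
  then show ?case by simp
next
  case (Suc N)
  have eq: "ordered_pairs (Suc N) = ordered_pairs N \<union> (\<lambda>m. (m, Suc N)) ` {1..N}"
    by (auto simp: ordered_pairs_def image_iff)
  have "card (ordered_pairs (Suc N)) = card (ordered_pairs N) + N"
    unfolding eq using finite_ordered_pairs[of N]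
    by (subst card_Un_disjoint) (auto simp: ordered_pairs_def card_image inj_on_def)
  with Suc show ?case by (cases N) (auto simp: algebra_simps)
qed

text \<open>Each of the N (N - 1) / 2 events has measure 2 X / N, so X (N - 1) / N is the mean. In
  the second moment the terms \<open>(2 * \<delta>)\<^sup>2\<close> add up to the square of the mean
  and cancel; the gcd terms are left.\<close>

lemma pair_corr_variance_le:
  assumes X: "0 \<le> X" "X / real N < 1 / 2" and N: "N > 0"
  shows "(\<integral>x. (pair_corr x N X - X * (real N - 1) / real N)\<^sup>2 \<partial>unit_unif)
    \<le> 8 * X * harm (2 * N) ^ 8 / real N"
proof -
  define \<delta> where "\<delta> = X / real N"
  define S where "S p = {x. dist_nearest_int (real (sq_diff p) * x) \<le> \<delta>}" for p
  have \<delta>: "0 \<le> \<delta>" "\<delta> < 1 / 2" using assms by (auto simp: \<delta>_def)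
  have [measurable]: "S p \<in> sets borel" for p unfolding S_def by measurable
  let ?P = "ordered_pairs N"
  define f where "f x = (\<Sum>p\<in>?P. indicator (S p) x :: real)" for x
  define \<mu> where "\<mu> = 2 * \<delta> * real (card ?P)"
  have int [simp]: "integrable unit_unif (indicator A :: real \<Rightarrow> real)" if "A \<in> sets borel" for A
    using that by (simp add: integrable_indicator_iff unit_unif.emeasure_finite less_top[symmetric])
  have int_f: "integrable unit_unif f"
    unfolding f_def by (intro Bochner_Integration.integrable_sum int) measurable
  have m1: "(\<integral>x. f x \<partial>unit_unif) = \<mu>"
  proof -
    have "measure unit_unif (S p) = 2 * \<delta>" if "p \<in> ?P" for p
      unfolding S_def by (rule measure_near_int_dilate[OF \<delta> sq_diff_pos[OF that]])
    then show ?thesis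
      unfolding f_def by (subst Bochner_Integration.integral_sum) (auto simp: \<mu>_def)
  qed
  have sq: "(f x)\<^sup>2 = (\<Sum>q\<in>?P. \<Sum>p\<in>?P. indicator (S p \<inter> S q) x)" for x
    unfolding f_def power2_eq_square sum_product
    by (subst sum.swap) (simp only: indicator_inter_arith)
  have int_f2: "integrable unit_unif (\<lambda>x. (f x)\<^sup>2)"
    unfolding sq by (intro Bochner_Integration.integrable_sum int) measurable
  have "(\<integral>x. (f x)\<^sup>2 \<partial>unit_unif) = (\<Sum>q\<in>?P. \<Sum>p\<in>?P. measure unit_unif (S p \<inter> S q))"
    unfolding sq by (subst Bochner_Integration.integral_sum; simp)+
  also have "\<dots> \<le> (\<Sum>q\<in>?P. \<Sum>p\<in>?P. (2 * \<delta>)\<^sup>2 + 2 * \<delta> * (real (gcd (sq_diff p) (sq_diff q)) / real (sq_diff q)))"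
  proof (intro sum_mono)
    fix q p assume "q \<in> ?P" "p \<in> ?P"
    then have "sq_diff p > 0" "sq_diff q > 0" by (auto dest: sq_diff_pos)
    from measure_near_int_pair_le[OF \<delta> this]
    show "measure unit_unif (S p \<inter> S q)
        \<le> (2 * \<delta>)\<^sup>2 + 2 * \<delta> * (real (gcd (sq_diff p) (sq_diff q)) / real (sq_diff q))"
      by (simp add: S_def Int_def)
  qed
  also have "\<dots> = \<mu>\<^sup>2 + 2 * \<delta> * (\<Sum>q\<in>?P. \<Sum>p\<in>?P. real (gcd (sq_diff p) (sq_diff q)) / real (sq_diff q))"
    by (simp add: sum.distrib sum_distrib_left \<mu>_def power2_eq_square)
  also have "\<dots> \<le> \<mu>\<^sup>2 + 2 * \<delta> * (4 * (real N)\<^sup>2 * harm (2 * N) ^ 8)"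
    by (intro add_left_mono mult_left_mono sum_gcd_div_sq_diff_le) (use \<delta> in simp)
  finally have m2: "(\<integral>x. (f x)\<^sup>2 \<partial>unit_unif) \<le> \<mu>\<^sup>2 + 8 * \<delta> * (real N)\<^sup>2 * harm (2 * N) ^ 8"
    by simp
  have "real (2 * card ?P) = real (N * (N - 1))" by (simp only: card_ordered_pairs)
  then have card: "2 * real (card ?P) = real N * (real N - 1)" using N by (simp add: of_nat_diff)
  have "\<mu> = \<delta> * (2 * real (card ?P))" by (simp add: \<mu>_def)
  also have "\<dots> = X * (real N - 1)" unfolding card using N by (simp add: \<delta>_def)
  finally have \<mu>: "\<mu> = X * (real N - 1)" .
  have "(pair_corr x N X - X * (real N - 1) / real N)\<^sup>2 = ((f x)\<^sup>2 - 2 * \<mu> * f x + \<mu>\<^sup>2) / (real N)\<^sup>2" for x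
  proof -
    have "pair_corr x N X - X * (real N - 1) / real N = (f x - \<mu>) / real N"
      by (simp add: pair_corr_eq_sum f_def S_def \<mu> \<delta>_def diff_divide_distrib)
    then have "(pair_corr x N X - X * (real N - 1) / real N)\<^sup>2 = (f x - \<mu>)\<^sup>2 / (real N)\<^sup>2"
      by (simp only: power_divide)
    also have "(f x - \<mu>)\<^sup>2 = (f x)\<^sup>2 - 2 * \<mu> * f x + \<mu>\<^sup>2"
      by (simp add: power2_diff)
    finally show ?thesis .
  qed
  then have "(\<integral>x. (pair_corr x N X - X * (real N - 1) / real N)\<^sup>2 \<partial>unit_unif)
      = ((\<integral>x. (f x)\<^sup>2 \<partial>unit_unif) - 2 * \<mu> * (\<integral>x. f x \<partial>unit_unif) + \<mu>\<^sup>2) / (real N)\<^sup>2"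
    using int_f int_f2 by (simp del: power_divide)
  also have "\<dots> \<le> (8 * \<delta> * (real N)\<^sup>2 * harm (2 * N) ^ 8) / (real N)\<^sup>2"
    using m2 by (intro divide_right_mono) (simp_all add: m1 power2_eq_square)
  also have "\<dots> = 8 * X * harm (2 * N) ^ 8 / real N"
    using N by (simp add: \<delta>_def)
  finally show ?thesis .
qed

lemma pair_corr_chebyshev:
  assumes "0 \<le> X" "X / real N < 1 / 2" "N > 0" "e > 0"
  shows "measure unit_unif {x. \<bar>pair_corr x N X - X * (real N - 1) / real N\<bar> \<ge> e}
    \<le> 8 * X * harm (2 * N) ^ 8 / (real N * e\<^sup>2)"
proof -
  let ?u = "\<lambda>x. (pair_corr x N X - X * (real N - 1) / real N)\<^sup>2"
  \<comment> \<open>Bounding the count by the number of pairs gives the integrability that Markov's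
    inequality requires of the squared deviation.\<close>
  have bd: "\<bar>pair_corr x N X\<bar> \<le> real (card (ordered_pairs N)) / real N" for x
  proof -
    have "\<bar>\<Sum>p\<in>ordered_pairs N. indicator {x. dist_nearest_int (real (sq_diff p) * x) \<le> X / real N} x :: real\<bar>
        \<le> (\<Sum>p\<in>ordered_pairs N. 1)"
      by (rule order_trans[OF sum_abs]) (intro sum_mono, simp add: indicator_def)
    then show ?thesis by (simp add: pair_corr_eq_sum abs_divide divide_right_mono)
  qed
  have "integrable unit_unif ?u"
  proof (rule unit_unif.integrable_const_bound)
    let ?B = "real (card (ordered_pairs N)) / real N + \<bar>X * (real N - 1) / real N\<bar>"
    show "AE x in unit_unif. norm (?u x) \<le> ?B\<^sup>2"
    proof (intro AE_I2)
      fix x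
      have "\<bar>pair_corr x N X - X * (real N - 1) / real N\<bar> \<le> ?B"
        using bd[of x] abs_triangle_ineq4[of "pair_corr x N X" "X * (real N - 1) / real N"] by linarith
      then show "norm (?u x) \<le> ?B\<^sup>2"
        by (simp add: power2_le_iff_abs_le abs_le_square_iff [symmetric])
    qed
  qed measurable
  moreover have "{x\<in>UNIV. ?u x \<ge> e\<^sup>2} = {x. \<bar>pair_corr x N X - X * (real N - 1) / real N\<bar> \<ge> e}"
    using assms(4) abs_le_square_iff[of e] by auto
  ultimately have "measure unit_unif {x. \<bar>pair_corr x N X - X * (real N - 1) / real N\<bar> \<ge> e}
      \<le> (\<integral>x. ?u x \<partial>unit_unif) / e\<^sup>2"
    using integral_Markov_inequality_measure[of unit_unif ?u UNIV "e\<^sup>2"] assms(4) by simp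
  also have "\<dots> \<le> (8 * X * harm (2 * N) ^ 8 / real N) / e\<^sup>2"
    by (intro divide_right_mono pair_corr_variance_le assms(1-3)) simp
  finally show ?thesis by (simp add: divide_divide_eq_left)
qed

section \<open>Almost everywhere convergence\<close>

lemma pair_corr_nonneg: "0 \<le> pair_corr x N X"
  by (simp add: pair_corr_def)

text \<open>All differences of squares are at most N^2, so passing from x to y moves every d x by at
  most |x - y| N^2, which the slack (Y - X) / N absorbs.\<close>

lemma pair_corr_perturb_le:
  assumes "N > 0" and "\<bar>x - y\<bar> * (real N)\<^sup>2 \<le> (Y - X) / real N"
  shows "pair_corr x N X \<le> pair_corr y N Y"
proof -
  have "dist_nearest_int (real (sq_diff p) * y) \<le> Y / real N"
    if p: "p \<in> ordered_pairs N" and "dist_nearest_int (real (sq_diff p) * x) \<le> X / real N" for p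
  proof -
    have "dist_nearest_int (real (sq_diff p) * x + real (sq_diff p) * (y - x))
        \<le> dist_nearest_int (real (sq_diff p) * x) + \<bar>real (sq_diff p) * (y - x)\<bar>"
      by (rule dist_nearest_int_add_le)
    also have "\<bar>real (sq_diff p) * (y - x)\<bar> = \<bar>x - y\<bar> * real (sq_diff p)"
      by (simp add: abs_mult abs_minus_commute)
    also have "\<dots> \<le> \<bar>x - y\<bar> * (real N)\<^sup>2"
    proof (rule mult_left_mono)
      have "real (sq_diff p) \<le> real (N * N)" using sq_diff_le[OF p] by (simp only: of_nat_le_iff)
      then show "real (sq_diff p) \<le> (real N)\<^sup>2" by (simp add: power2_eq_square)
    qed simp
    also note assms(2)
    finally show ?thesis using that(2) by (simp add: algebra_simps diff_divide_distrib)
  qed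
  then show ?thesis
    unfolding pair_corr_eq_sum by (intro divide_right_mono sum_mono) (auto simp: indicator_def)
qed

text \<open>Enlarging N to M only adds pairs, and multiplying X by M / N keeps the threshold X / N
  unchanged.\<close>

lemma pair_corr_rescale_le:
  assumes "0 < N" "N \<le> M"
  shows "real N * pair_corr x N X \<le> real M * pair_corr x M (X * (real M / real N))"
proof -
  have sub: "ordered_pairs N \<subseteq> ordered_pairs M"
    using assms(2) by (auto simp: ordered_pairs_def)
  have "X * (real M / real N) / real M = X / real N" using assms by simp
  then show ?thesis
    unfolding pair_corr_eq_sum using assms by (simp add: sum_mono2[OF _ sub])
qed

text \<open>X runs over the multiples of 1 / j up to j: finitely many values, so that integer
  arithmetic can test the condition. The exponent 8 makes the exceptional measures summable.\<close>

definition level_ok :: "nat \<Rightarrow> real \<Rightarrow> bool" where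
  "level_ok j x \<longleftrightarrow>
     (\<forall>u\<le>j\<^sup>2. \<bar>pair_corr x (j ^ 8) (real u / real j) - real u / real j\<bar> \<le> 1 / real j)"

text \<open>In contrast to \<^const>\<open>level_ok\<close>, this condition is inherited by limits of points.\<close>

definition level_near :: "nat \<Rightarrow> real \<Rightarrow> bool" where
  "level_near j x \<longleftrightarrow>
     (\<forall>X. 0 \<le> X \<longrightarrow> X + 1 \<le> real j \<longrightarrow> \<bar>pair_corr x (j ^ 8) X - X\<bar> \<le> 2 / real j)"

text \<open>X is compared with a grid point strictly above or below it, and the positive gap absorbs
  the move from x to \<open>xs n\<close> for large n. The gap costs 1 / j, and
  \<open>level_ok\<close> another 1 / j.\<close>

lemma level_near_limit:
  assumes lim: "xs \<longlonglongrightarrow> x" and ok: "\<forall>\<^sub>F n in sequentially. level_ok j (xs n)" and j: "j > 0"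
  shows "level_near j x"
  unfolding level_near_def
proof (intro allI impI)
  fix X :: real assume X: "0 \<le> X" "X + 1 \<le> real j"
  define N where "N = j ^ 8"
  have N: "N > 0" using j by (simp add: N_def)
  have close: "\<forall>\<^sub>F n in sequentially. \<bar>x - xs n\<bar> * (real N)\<^sup>2 \<le> e" if "e > 0" for e
  proof -
    have "(\<lambda>n. \<bar>x - xs n\<bar> * (real N)\<^sup>2) \<longlonglongrightarrow> \<bar>x - x\<bar> * (real N)\<^sup>2"
      by (intro tendsto_intros lim)
    then have "\<forall>\<^sub>F n in sequentially. \<bar>x - xs n\<bar> * (real N)\<^sup>2 < e"
      using that by (intro order_tendstoD) auto
    then show ?thesis by (rule eventually_mono) simp
  qed
  have Xj: "X * real j \<le> (real j - 1) * real j" using X j by (intro mult_right_mono) auto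
  have "pair_corr x N X \<le> X + 2 / real j"
  proof -
    \<comment> \<open>Floor plus one instead of a ceiling: the grid point must exceed X strictly
      even when X j is an integer. The bound X + 1 \<le> j keeps u in range.\<close>
    define u where "u = nat \<lfloor>X * real j\<rfloor> + 1"
    have fl: "real u = of_int \<lfloor>X * real j\<rfloor> + 1" using X by (simp add: u_def)
    have lt: "X * real j < real u" and le: "real u \<le> X * real j + 1" unfolding fl by linarith+
    have "real u \<le> (real j)\<^sup>2" using le Xj j by (simp add: power2_eq_square algebra_simps)
    then have "real u \<le> real (j\<^sup>2)" by simp
    then have u: "u \<le> j\<^sup>2" by (simp only: of_nat_le_iff)
    have Y: "X < real u / real j" "real u / real j \<le> X + 1 / real j"
      using lt le j by (simp_all add: field_simps)
    from Y have "(real u / real j - X) / real N > 0" using N by simp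
    from eventually_conj[OF close[OF this] ok] obtain n where n:
      "\<bar>x - xs n\<bar> * (real N)\<^sup>2 \<le> (real u / real j - X) / real N" "level_ok j (xs n)"
      by (auto dest: eventually_happens)
    have "pair_corr x N X \<le> pair_corr (xs n) N (real u / real j)"
      by (rule pair_corr_perturb_le[OF N n(1)])
    also have "\<dots> \<le> real u / real j + 1 / real j"
      using n(2) u unfolding level_ok_def N_def by (auto simp: abs_le_iff)
    also have "\<dots> \<le> X + 2 / real j" using Y(2) by simp
    finally show ?thesis .
  qed
  moreover have "X - 2 / real j \<le> pair_corr x N X"
  proof (cases "X * real j \<le> 2")
    case True
    then have "X \<le> 2 / real j" using j by (simp add: field_simps)
    then show ?thesis using pair_corr_nonneg[of x N X] by linarith
  next
    case False
    \<comment> \<open>Likewise the largest integer strictly below X j, which is nonnegative because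
      X j > 2 in this case.\<close>
    define u where "u = nat (\<lceil>X * real j\<rceil> - 1)"
    have fl: "real u = of_int \<lceil>X * real j\<rceil> - 1" using False by (simp add: u_def)
    have lt: "real u < X * real j" and le: "X * real j \<le> real u + 1" unfolding fl by linarith+
    have "real u \<le> (real j)\<^sup>2" using lt Xj j by (simp add: power2_eq_square algebra_simps)
    then have "real u \<le> real (j\<^sup>2)" by simp
    then have u: "u \<le> j\<^sup>2" by (simp only: of_nat_le_iff)
    have Y: "real u / real j < X" "X \<le> real u / real j + 1 / real j"
      using lt le j by (simp_all add: field_simps)
    from Y have "(X - real u / real j) / real N > 0" using N by simp
    from eventually_conj[OF close[OF this] ok] obtain n where n:
      "\<bar>x - xs n\<bar> * (real N)\<^sup>2 \<le> (X - real u / real j) / real N" "level_ok j (xs n)"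
      by (auto dest: eventually_happens)
    have "X - 2 / real j \<le> real u / real j - 1 / real j" using Y(2) by simp
    also have "\<dots> \<le> pair_corr (xs n) N (real u / real j)"
      using n(2) u unfolding level_ok_def N_def by (auto simp: abs_le_iff algebra_simps)
    also have "\<dots> \<le> pair_corr x N X"
      by (rule pair_corr_perturb_le[OF N]) (use n(1) in \<open>simp add: abs_minus_commute\<close>)
    finally show ?thesis .
  qed
  ultimately show "\<bar>pair_corr x (j ^ 8) X - X\<bar> \<le> 2 / real j"
    unfolding N_def by linarith
qed

section \<open>Interpolation between consecutive eighth powers\<close>

definition root8 :: "nat \<Rightarrow> nat" where
  "root8 N = nat \<lfloor>root 8 (real N)\<rfloor>"

lemma root8_power_le: "root8 N ^ 8 \<le> N"
proof -
  have "real (root8 N) \<le> root 8 (real N)" by (simp add: root8_def)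
  then have "real (root8 N) ^ 8 \<le> root 8 (real N) ^ 8" by (rule power_mono) simp
  then have "real (root8 N ^ 8) \<le> real N" by simp
  then show ?thesis by (simp only: of_nat_le_iff)
qed

lemma less_Suc_root8_power: "N < Suc (root8 N) ^ 8"
proof -
  have "root 8 (real N) \<ge> 0" by simp
  then have "root 8 (real N) < real (Suc (root8 N))" unfolding root8_def by linarith
  then have "root 8 (real N) ^ 8 < real (Suc (root8 N)) ^ 8" by (rule power_strict_mono) auto
  then have "real N < real (Suc (root8 N) ^ 8)" by simp
  then show ?thesis by (simp only: of_nat_less_iff)
qed

lemma filterlim_root8: "filterlim root8 at_top sequentially"
proof -
  have "mono root8"
    by (rule monoI) (simp add: root8_def nat_mono floor_mono)
  moreover have "root8 (k ^ 8) = k" for k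
    by (simp add: root8_def real_root_power_cancel)
  ultimately show ?thesis
    unfolding filterlim_at_top eventually_sequentially by (metis monoD)
qed

lemma pair_corr_converges_if_level_near:
  assumes "\<forall>\<^sub>F j in sequentially. level_near j x"
  shows "pair_corr_converges x"
  unfolding pair_corr_converges_def
proof (intro allI impI)
  fix X :: real assume X: "0 \<le> X"
  \<comment> \<open>\<open>\<rho> j\<close> is the ratio of consecutive eighth powers. In the main
    terms of \<open>lo\<close> and \<open>hi\<close> one factor comes from changing the
    normalization 1 / N and one from rescaling X.\<close>
  define \<rho> where "\<rho> j = ((real j + 1) / real j) ^ 8" for j
  define lo where "lo j = X / (\<rho> j)\<^sup>2 - 2 / real j" for j
  define hi where "hi j = X * (\<rho> j)\<^sup>2 + 2 * \<rho> j / real j" for j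
  have lo: "lo \<longlonglongrightarrow> X" unfolding lo_def \<rho>_def by real_asymp
  have hi: "hi \<longlonglongrightarrow> X" unfolding hi_def \<rho>_def by real_asymp
  \<comment> \<open>Keeps the rescaled argument X M / N in the range that \<open>level_near\<close>
    covers at level j + 1.\<close>
  have small: "\<forall>\<^sub>F j in sequentially. X * \<rho> j \<le> real j"
    unfolding \<rho>_def by real_asymp
  have Xj: "\<forall>\<^sub>F j in sequentially. X + 1 \<le> real j" by real_asymp
  have next_near: "\<forall>\<^sub>F j in sequentially. level_near (Suc j) x"
    using assms by (subst eventually_sequentially_Suc)
  from small Xj next_near assms eventually_gt_at_top[of 0]
  have "\<forall>\<^sub>F j in sequentially. \<forall>N. root8 N = j \<longrightarrow> lo j \<le> pair_corr x N X \<and> pair_corr x N X \<le> hi j"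
  proof eventually_elim
    case (elim j)
    show ?case
    proof (intro allI impI)
      fix N assume N: "root8 N = j"
      define L where "L = j ^ 8"
      define M where "M = Suc j ^ 8"
      have LN: "L \<le> N" and NM: "N \<le> M"
        using root8_power_le[of N] less_Suc_root8_power[of N] by (simp_all add: N L_def M_def)
      have L0: "L > 0" using elim by (simp add: L_def)
      have N0: "N > 0" using L0 LN by simp
      have ratio: "real M / real L = \<rho> j"
        by (simp add: M_def L_def \<rho>_def power_divide add.commute)
      have \<rho>1: "real M / real N \<le> \<rho> j"
        unfolding ratio [symmetric] using LN L0 by (intro divide_left_mono) auto
      have \<rho>0: "\<rho> j > 0" using elim by (simp add: \<rho>_def)
      have \<rho>2: "1 / \<rho> j \<le> real L / real N"
      proof -
        have "1 / \<rho> j = real L / real M" by (simp flip: ratio)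
        also have "\<dots> \<le> real L / real N" using NM N0 by (intro divide_left_mono) auto
        finally show ?thesis .
      qed
      have "real N * pair_corr x N X \<le> real M * pair_corr x M (X * (real M / real N))"
        by (rule pair_corr_rescale_le[OF N0 NM])
      also have "pair_corr x M (X * (real M / real N)) \<le> X * (real M / real N) + 2 / real (Suc j)"
      proof -
        have "X * (real M / real N) \<le> X * \<rho> j" using \<rho>1 X by (rule mult_left_mono)
        then have "X * (real M / real N) + 1 \<le> real (Suc j)" using elim by simp
        moreover have "0 \<le> X * (real M / real N)" using X by simp
        ultimately have "\<bar>pair_corr x M (X * (real M / real N)) - X * (real M / real N)\<bar> \<le> 2 / real (Suc j)"
          using elim unfolding level_near_def M_def by blast
        then show ?thesis by linarith
      qed
      finally have "real N * pair_corr x N X \<le> real M * (X * (real M / real N) + 2 / real (Suc j))"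
        by (simp add: mult_left_mono)
      then have "pair_corr x N X \<le> real M * (X * (real M / real N) + 2 / real (Suc j)) / real N"
        using N0 by (simp only: pos_le_divide_eq of_nat_0_less_iff mult.commute)
      also have "\<dots> = real M / real N * (X * (real M / real N) + 2 / real (Suc j))" by simp
      also have "\<dots> \<le> \<rho> j * (X * \<rho> j + 2 / real j)"
        using \<rho>0 \<rho>1 X elim by (intro mult_mono add_mono divide_left_mono) auto
      also have "\<dots> = hi j" by (simp add: hi_def power2_eq_square algebra_simps)
      finally have up: "pair_corr x N X \<le> hi j" .
      have "\<bar>pair_corr x L (X * (real L / real N)) - X * (real L / real N)\<bar> \<le> 2 / real j"
      proof -
        have "X * (real L / real N) \<le> X * 1"
          using LN N0 X by (intro mult_left_mono) (auto simp: divide_le_eq)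
        then have "X * (real L / real N) + 1 \<le> real j" using elim by simp
        moreover have "0 \<le> X * (real L / real N)" using X by simp
        ultimately show ?thesis using elim unfolding level_near_def L_def by blast
      qed
      then have "X * (real L / real N) - 2 / real j \<le> pair_corr x L (X * (real L / real N))"
        by linarith
      then have "real L * (X * (real L / real N) - 2 / real j) \<le> real L * pair_corr x L (X * (real L / real N))"
        by (rule mult_left_mono) simp
      also have "\<dots> \<le> real N * pair_corr x N X"
        using pair_corr_rescale_le[OF L0 LN, of x "X * (real L / real N)"] L0 N0 by simp
      finally have "real L / real N * (X * (real L / real N)) - real L / real N * (2 / real j) \<le> pair_corr x N X"
        using N0 by (simp add: field_simps)
      moreover have "real L / real N * (2 / real j) \<le> 1 * (2 / real j)"
        using LN N0 by (intro mult_right_mono) (auto simp: divide_le_eq)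
      moreover have "X * ((1 / \<rho> j) * (1 / \<rho> j)) \<le> X * (real L / real N * (real L / real N))"
        using \<rho>2 \<rho>0 X by (intro mult_left_mono mult_mono) auto
      ultimately have "lo j \<le> pair_corr x N X"
        by (simp add: lo_def power2_eq_square algebra_simps)
      with up show "lo j \<le> pair_corr x N X \<and> pair_corr x N X \<le> hi j" by blast
    qed
  qed
  \<comment> \<open>Quantifying over all \<open>N'\<close> with the same root makes the bounds a
    property of \<open>root8 N\<close> alone, which can be composed with its limit.\<close>
  then have ev: "\<forall>\<^sub>F N in sequentially. \<forall>N'. root8 N' = root8 N \<longrightarrow>
      lo (root8 N) \<le> pair_corr x N' X \<and> pair_corr x N' X \<le> hi (root8 N)"
    by (rule eventually_compose_filterlim[OF _ filterlim_root8])
  show "(\<lambda>N. pair_corr x N X) \<longlonglongrightarrow> X"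
  proof (rule tendsto_sandwich)
    show "\<forall>\<^sub>F N in sequentially. lo (root8 N) \<le> pair_corr x N X"
      using ev by (rule eventually_mono) blast
    show "\<forall>\<^sub>F N in sequentially. pair_corr x N X \<le> hi (root8 N)"
      using ev by (rule eventually_mono) blast
    show "(\<lambda>N. lo (root8 N)) \<longlonglongrightarrow> X" by (rule filterlim_compose[OF lo filterlim_root8])
    show "(\<lambda>N. hi (root8 N)) \<longlonglongrightarrow> X" by (rule filterlim_compose[OF hi filterlim_root8])
  qed
qed

text \<open>Serves almost every point with a constant sequence and the algorithm with cell
  midpoints; the n from which a level holds may depend on the level.\<close>

lemma pair_corr_converges_limit:
  assumes "xs \<longlonglongrightarrow> x" and "\<forall>\<^sub>F j in sequentially. \<forall>\<^sub>F n in sequentially. level_ok j (xs n)"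
  shows "pair_corr_converges x"
proof (rule pair_corr_converges_if_level_near)
  show "\<forall>\<^sub>F j in sequentially. level_near j x"
    using assms(2) eventually_gt_at_top[of 0] by eventually_elim (rule level_near_limit[OF assms(1)])
qed

section \<open>Exceptional sets and the Borel-Cantelli argument\<close>

abbreviation bad_set :: "nat \<Rightarrow> real set" where
  "bad_set j \<equiv> {x. \<not> level_ok j x}"

lemma bad_set_measurable [measurable]: "bad_set j \<in> sets borel"
  unfolding level_ok_def by measurable

lemma level_ok_add_of_int [simp]: "level_ok j (x + of_int k) \<longleftrightarrow> level_ok j x"
  by (simp add: level_ok_def)

lemma harm_le_ln: "n > 0 \<Longrightarrow> harm n \<le> 1 + ln (real n)"
  using decseqD[OF decseq_harm_diff_ln, of 0 "n - 1"] by (simp add: harm_expand)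

text \<open>A union bound over the j^2 + 1 grid values of X. Half of the tolerance 1 / j pays for
  the difference X / N between X and the mean, half is left for Chebyshev; with X \<le> j the
  product 8 j (2 j)^2 gives the factor 32 j^3.\<close>

lemma measure_bad_set_le:
  assumes j: "j \<ge> 2"
  shows "measure unit_unif (bad_set j)
    \<le> ((real j)\<^sup>2 + 1) * (32 * real j ^ 3 * (1 + ln (2 * real j ^ 8)) ^ 8 / real j ^ 8)"
proof -
  define N where "N = j ^ 8"
  have N0: "N > 0" using j by (simp add: N_def)
  have N: "real N = real j ^ 8" by (simp add: N_def)
  define H where "H = 1 + ln (2 * real j ^ 8)"
  have harm: "harm (2 * N) \<le> H" using harm_le_ln[of "2 * N"] N0 by (simp add: H_def N)
  let ?A = "\<lambda>u. {x. \<bar>pair_corr x N (real u / real j) - real u / real j * (real N - 1) / real N\<bar> \<ge> 1 / (2 * real j)}"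
  have jN: "2 * (real j)\<^sup>2 \<le> real N"
  proof -
    have "2 * j\<^sup>2 \<le> j * j\<^sup>2" using j by (intro mult_le_mono) auto
    also have "\<dots> = j ^ 3" by (simp add: eval_nat_numeral)
    also have "\<dots> \<le> j ^ 8" using j by (intro power_increasing) auto
    finally have "real (2 * j\<^sup>2) \<le> real N" unfolding N_def by (simp only: of_nat_le_iff)
    then show ?thesis by simp
  qed
  have Xle: "real u / real j \<le> real j" if "u \<le> j\<^sup>2" for u
  proof -
    have "real u \<le> real (j\<^sup>2)" using that by (simp only: of_nat_le_iff)
    then show ?thesis using j by (simp add: field_simps power2_eq_square)
  qed
  have XN: "real u / real j / real N \<le> 1 / (2 * real j)" if "u \<le> j\<^sup>2" for u
  proof -
    have "real u / real j * (2 * real j) \<le> real j * (2 * real j)"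
      using Xle[OF that] by (intro mult_right_mono) auto
    also have "\<dots> \<le> real N" using jN by (simp add: power2_eq_square)
    finally show ?thesis using N0 j by (simp add: field_simps)
  qed
  have meas_A [measurable]: "?A u \<in> sets borel" for u by measurable
  have "bad_set j \<subseteq> (\<Union>u\<in>{..j\<^sup>2}. ?A u)"
  proof
    fix x assume "x \<in> bad_set j"
    then obtain u where u: "u \<le> j\<^sup>2"
      and *: "\<bar>pair_corr x N (real u / real j) - real u / real j\<bar> > 1 / real j"
      unfolding level_ok_def N_def by (auto simp: not_le)
    have "real u / real j * (real N - 1) / real N = real u / real j - real u / real j / real N"
      using N0 j by (simp add: field_simps)
    moreover have "1 / real j = 1 / (2 * real j) + 1 / (2 * real j)" by simp
    moreover have "0 \<le> real u / real j / real N" by simp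
    ultimately have "1 / (2 * real j)
        \<le> \<bar>pair_corr x N (real u / real j) - real u / real j * (real N - 1) / real N\<bar>"
      using * XN[OF u] by linarith
    then show "x \<in> (\<Union>u\<in>{..j\<^sup>2}. ?A u)" using u by blast
  qed
  then have "measure unit_unif (bad_set j) \<le> measure unit_unif (\<Union>u\<in>{..j\<^sup>2}. ?A u)"
    by (intro unit_unif.finite_measure_mono) auto
  also have "\<dots> \<le> (\<Sum>u\<in>{..j\<^sup>2}. measure unit_unif (?A u))"
    by (intro unit_unif.finite_measure_subadditive_finite) auto
  also have "\<dots> \<le> (\<Sum>u\<in>{..j\<^sup>2}. 32 * real j ^ 3 * H ^ 8 / real j ^ 8)"
  proof (rule sum_mono)
    fix u assume "u \<in> {..j\<^sup>2}"
    then have u: "u \<le> j\<^sup>2" by simp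
    have "1 / (2 * real j) < 1 / 2" using j by (simp add: field_simps)
    with XN[OF u] have "real u / real j / real N < 1 / 2" by linarith
    then have "measure unit_unif (?A u) \<le> 8 * (real u / real j) * harm (2 * N) ^ 8 / (real N * (1 / (2 * real j))\<^sup>2)"
      by (intro pair_corr_chebyshev) (use N0 j in simp_all)
    also have "\<dots> \<le> 8 * real j * H ^ 8 / (real N * (1 / (2 * real j))\<^sup>2)"
      using Xle[OF u] harm by (intro divide_right_mono mult_mono power_mono mult_left_mono) (auto simp: harm_nonneg)
    also have "\<dots> = 32 * real j ^ 3 * H ^ 8 / real j ^ 8"
      using j by (simp add: N power2_eq_square power3_eq_cube)
    finally show "measure unit_unif (?A u) \<le> 32 * real j ^ 3 * H ^ 8 / real j ^ 8" .
  qed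
  also have "\<dots> = ((real j)\<^sup>2 + 1) * (32 * real j ^ 3 * H ^ 8 / real j ^ 8)"
    by (simp add: add.commute)
  finally show ?thesis unfolding H_def .
qed

text \<open>The bound is of order (log j)^8 / j^3: about j^2 values of X, each costing j^3 (log j)^8
  / j^8.\<close>

lemma summable_measure_bad_set: "summable (\<lambda>j. measure unit_unif (bad_set j))"
proof -
  let ?g = "\<lambda>j::nat. ((real j)\<^sup>2 + 1) * (32 * real j ^ 3 * (1 + ln (2 * real j ^ 8)) ^ 8 / real j ^ 8)"
  have "summable ?g"
  proof (rule summable_comparison_test_bigo)
    show "summable (\<lambda>j. norm (1 / real j ^ 2))"
      using inverse_power_summable[of 2, where 'a = real] by (simp add: inverse_eq_divide)
    show "?g \<in> O(\<lambda>j. 1 / real j ^ 2)" by real_asymp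
  qed
  moreover have "\<forall>\<^sub>F j in sequentially. norm (measure unit_unif (bad_set j)) \<le> ?g j"
    using eventually_ge_at_top[of 2] 
    by eventually_elim (metis abs_of_nonneg measure_bad_set_le measure_nonneg real_norm_def)
  ultimately show ?thesis by (rule summable_comparison_test_ev[rotated])
qed

lemma emeasure_periodic_unit_interval:
  assumes [measurable]: "S \<in> sets borel" and "\<And>x. x + 1 \<in> S \<longleftrightarrow> x \<in> S"
  shows "emeasure lborel ({real_of_int k..<real_of_int k + 1} \<inter> S) = emeasure unit_unif S"
  using emeasure_periodic_interval[OF assms] by (simp add: emeasure_unit_unif)

lemma bad_set_periodic: "x + 1 \<in> bad_set j \<longleftrightarrow> x \<in> bad_set j"
  using level_ok_add_of_int[of j x 1] by simp

text \<open>A periodic set can have infinite measure on the line, so Borel-Cantelli is applied in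
  each of the countably many unit intervals [k, k + 1).\<close>

lemma AE_pair_corr_converges: "AE x in lebesgue. pair_corr_converges x"
proof -
  have "AE x in lborel. \<forall>\<^sub>F j in sequentially. x \<in> space lborel - {real_of_int k..<real_of_int k + 1} \<inter> bad_set j" for k
  proof (rule borel_cantelli_AE1)
    have eq: "emeasure lborel ({real_of_int k..<real_of_int k + 1} \<inter> bad_set j) = emeasure unit_unif (bad_set j)" for j
      by (rule emeasure_periodic_unit_interval[OF bad_set_measurable bad_set_periodic])
    show "emeasure lborel ({real_of_int k..<real_of_int k + 1} \<inter> bad_set j) < \<infinity>" for j
      by (simp add: eq less_top[symmetric])
    show "summable (\<lambda>j. measure lborel ({real_of_int k..<real_of_int k + 1} \<inter> bad_set j))"
      using summable_measure_bad_set by (simp add: measure_def eq)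
  qed measurable
  then have "AE x in lborel. \<forall>k. \<forall>\<^sub>F j in sequentially. x \<in> space lborel - {real_of_int k..<real_of_int k + 1} \<inter> bad_set j"
    by (subst AE_all_countable) simp
  then have "AE x in lborel. pair_corr_converges x"
  proof (rule AE_mp, intro AE_I2 impI)
    fix x :: real
    assume "\<forall>k. \<forall>\<^sub>F j in sequentially. x \<in> space lborel - {real_of_int k..<real_of_int k + 1} \<inter> bad_set j"
    then have "\<forall>\<^sub>F j in sequentially. x \<in> space lborel - {real_of_int \<lfloor>x\<rfloor>..<real_of_int \<lfloor>x\<rfloor> + 1} \<inter> bad_set j" ..
    then have ev: "\<forall>\<^sub>F j in sequentially. level_ok j x"
      by (rule eventually_mono) auto
    show "pair_corr_converges x"
      by (rule pair_corr_converges_limit[of "\<lambda>_. x"]) (use ev in simp_all)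
  qed
  then show ?thesis by (rule AE_completion)
qed

text \<open>From \<open>j0\<close> on the exceptional measures sum to less than the length 1 / B, so
  these sets cannot cover the interval, even together with the null set of grid points z / D.
  Avoiding grid points puts x inside an open cell.\<close>

lemma ex_levels_ok_in_interval:
  fixes B :: nat
  assumes B: "B > 0"
  shows "\<exists>j0>0. \<forall>(A::nat) (D::nat) k. D > 0 \<longrightarrow> (\<exists>x. real A / real B \<le> x \<and> x < (real A + 1) / real B
       \<and> real D * x \<notin> \<int> \<and> (\<forall>j. j0 \<le> j \<longrightarrow> j \<le> k \<longrightarrow> level_ok j x))"
proof -
  let ?f = "\<lambda>j. measure unit_unif (bad_set j)"
  obtain n0 where n0: "\<forall>n\<ge>n0. norm (\<Sum>i. ?f (i + n)) < 1 / real B"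
    using suminf_exist_split[OF _ summable_measure_bad_set, of "1 / real B"] B by auto
  define j0 where "j0 = Suc n0"
  have "\<exists>x. real A / real B \<le> x \<and> x < (real A + 1) / real B \<and> real D * x \<notin> \<int>
      \<and> (\<forall>j. j0 \<le> j \<longrightarrow> j \<le> k \<longrightarrow> level_ok j x)" if D: "D > 0" for A D k :: nat
  proof (rule ccontr)
    assume contra: "\<not> ?thesis"
    define U where "U = (\<Union>j\<in>{j0..k}. bad_set j)"
    have [measurable]: "U \<in> sets borel" unfolding U_def by measurable
    have U_per: "x + 1 \<in> U \<longleftrightarrow> x \<in> U" for x
      unfolding U_def using bad_set_periodic by blast
    have "measure unit_unif U \<le> (\<Sum>j\<in>{j0..k}. ?f j)"
      unfolding U_def by (intro unit_unif.finite_measure_subadditive_finite) auto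
    also have "\<dots> = (\<Sum>i\<in>{0..<Suc k - j0}. ?f (i + j0))"
      by (simp only: atLeastLessThanSuc_atLeastAtMost [symmetric] sum.atLeastLessThan_shift_0[of ?f j0]
          comp_def add.commute[of j0])
    also have "\<dots> \<le> (\<Sum>i. ?f (i + j0))"
      using summable_ignore_initial_segment[OF summable_measure_bad_set, of j0]
      by (rule sum_le_suminf) auto
    also have "\<dots> < 1 / real B" using n0[rule_format, of j0] by (simp add: j0_def)
    finally have small: "measure unit_unif U < 1 / real B" .
    \<comment> \<open>As A and B are integers, [A / B, (A + 1) / B) lies in the single period [c, c
      + 1).\<close>
    define c where "c = int (A div B)"
    define G where "G = range (\<lambda>z::int. real_of_int z / real D)"
    have G: "countable G" by (simp add: G_def)
    have "emeasure lborel G = 0" by (rule emeasure_lborel_countable[OF G])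
    have [measurable]: "G \<in> sets borel" by (rule sets.countable[OF _ G]) simp
    have sub: "{real A / real B..<(real A + 1) / real B} \<subseteq> ({real_of_int c..<real_of_int c + 1} \<inter> U) \<union> G"
    proof
      fix x assume x: "x \<in> {real A / real B..<(real A + 1) / real B}"
      show "x \<in> ({real_of_int c..<real_of_int c + 1} \<inter> U) \<union> G"
      proof (cases "real D * x \<in> \<int>")
        case True
        then obtain z where "real D * x = of_int z" by (elim Ints_cases)
        then have "x = of_int z / real D" using D by (simp add: field_simps)
        then show ?thesis by (auto simp: G_def)
      next
        case False
        then obtain j where "j \<in> {j0..k}" "\<not> level_ok j x" using contra x by auto
        then have "x \<in> U" by (auto simp: U_def)
        moreover have "real (A div B) \<le> real A / real B"
        proof -
          have "real (A div B * B) \<le> real A" by (simp only: of_nat_le_iff div_times_less_eq_dividend)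
          then show ?thesis using B by (simp add: pos_le_divide_eq)
        qed
        moreover have "(real A + 1) / real B \<le> real (A div B) + 1"
        proof -
          have "A < (A div B + 1) * B" using B by (simp add: dividend_less_div_times)
          then have "A + 1 \<le> (A div B + 1) * B" by simp
          then have "real (A + 1) \<le> real ((A div B + 1) * B)" by (simp only: of_nat_le_iff)
          then show ?thesis using B by (simp add: field_simps)
        qed
        ultimately show ?thesis using x by (auto simp: c_def)
      qed
    qed
    have "ennreal (1 / real B) = emeasure lborel {real A / real B..<(real A + 1) / real B}"
      using B by (simp add: divide_right_mono) (simp add: add_divide_distrib)
    also have "\<dots> \<le> emeasure lborel (({real_of_int c..<real_of_int c + 1} \<inter> U) \<union> G)"
      using sub by (rule emeasure_mono) measurable
    also have "\<dots> \<le> emeasure lborel ({real_of_int c..<real_of_int c + 1} \<inter> U) + emeasure lborel G"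
      by (rule emeasure_subadditive) measurable
    also have "\<dots> = ennreal (measure unit_unif U)"
      using emeasure_periodic_unit_interval[of U c] U_per \<open>emeasure lborel G = 0\<close>
      by (simp add: unit_unif.emeasure_eq_measure)
    finally show False using small by (simp add: ennreal_le_iff)
  qed
  then show ?thesis unfolding j0_def by blast
qed

section \<open>Total recursive functions\<close>

definition rec_fun :: "nat \<Rightarrow> (nat list \<Rightarrow> nat) \<Rightarrow> bool" where
  "rec_fun n f \<longleftrightarrow> (\<exists>p. \<forall>xs. length xs = n \<longrightarrow> rec_eval p xs (f xs))"

definition rec_pred :: "nat \<Rightarrow> (nat list \<Rightarrow> bool) \<Rightarrow> bool" where
  "rec_pred n P \<longleftrightarrow> rec_fun n (\<lambda>xs. of_bool (P xs))"

lemma computable_if_rec_fun: "rec_fun 1 (\<lambda>xs. f (xs ! 0)) \<Longrightarrow> computable f"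
  unfolding computable_def rec_fun_def by (metis One_nat_def length_Cons list.size(3) nth_Cons_0)

lemma rec_fun_cong:
  "rec_fun n f \<Longrightarrow> (\<And>xs. length xs = n \<Longrightarrow> f xs = g xs) \<Longrightarrow> rec_fun n g"
  by (auto simp: rec_fun_def)

lemma rec_fun_nth: "i < n \<Longrightarrow> rec_fun n (\<lambda>xs. xs ! i)"
  unfolding rec_fun_def by (auto intro: rec_eval.Proj)

lemma rec_fun_comp:
  assumes f: "rec_fun (length gs) f" and gs: "\<And>g. g \<in> set gs \<Longrightarrow> rec_fun n g"
  shows "rec_fun n (\<lambda>xs. f (map (\<lambda>g. g xs) gs))"
proof -
  obtain p where p: "\<And>xs. length xs = length gs \<Longrightarrow> rec_eval p xs (f xs)"
    using f by (auto simp: rec_fun_def)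
  obtain P where P: "\<And>g xs. g \<in> set gs \<Longrightarrow> length xs = n \<Longrightarrow> rec_eval (P g) xs (g xs)"
    using gs unfolding rec_fun_def by metis
  have "rec_eval (Comp p (map P gs)) xs (f (map (\<lambda>g. g xs) gs))" if "length xs = n" for xs
  proof (rule rec_eval.Comp)
    show "list_all2 (\<lambda>g y. rec_eval g xs y) (map P gs) (map (\<lambda>g. g xs) gs)"
      using P that by (simp add: list_all2_map1 list_all2_map2 list_all2_same)
  qed (simp add: p)
  then show ?thesis unfolding rec_fun_def by blast
qed

lemma rec_fun_Cons:
  assumes "rec_fun (Suc n) f" "rec_fun n b"
  shows "rec_fun n (\<lambda>xs. f (b xs # xs))"
proof (rule rec_fun_cong)
  let ?gs = "b # map (\<lambda>i xs. xs ! i) [0..<n]"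
  show "rec_fun n (\<lambda>xs. f (map (\<lambda>g. g xs) ?gs))"
    using assms by (intro rec_fun_comp) (auto intro: rec_fun_nth)
  show "f (map (\<lambda>g. g xs) ?gs) = f (b xs # xs)" if "length xs = n" for xs
    using map_nth[of xs] that by (simp add: comp_def)
qed

lemma rec_fun_tl:
  assumes "rec_fun n f"
  shows "rec_fun (Suc n) (\<lambda>xs. f (tl xs))"
proof (rule rec_fun_cong)
  let ?gs = "map (\<lambda>i xs. xs ! Suc i) [0..<n]"
  show "rec_fun (Suc n) (\<lambda>xs. f (map (\<lambda>g. g xs) ?gs))"
    using assms by (intro rec_fun_comp) (auto intro: rec_fun_nth)
  show "f (map (\<lambda>g. g xs) ?gs) = f (tl xs)" if "length xs = Suc n" for xs
    using map_nth[of "tl xs"] that by (cases xs) (simp_all add: comp_def)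
qed

text \<open>Drops the running value of a primitive recursion, so that a summand depending on index
  and parameters can enter the step function.\<close>

lemma rec_fun_skip:
  assumes "rec_fun (Suc n) f"
  shows "rec_fun (Suc (Suc n)) (\<lambda>xs. f (xs ! 0 # tl (tl xs)))"
proof (rule rec_fun_cong)
  let ?gs = "(\<lambda>xs. xs ! 0) # map (\<lambda>i xs. xs ! Suc (Suc i)) [0..<n]"
  show "rec_fun (Suc (Suc n)) (\<lambda>xs. f (map (\<lambda>g. g xs) ?gs))"
    using assms by (intro rec_fun_comp) (auto intro: rec_fun_nth)
  show "f (map (\<lambda>g. g xs) ?gs) = f (xs ! 0 # tl (tl xs))" if "length xs = Suc (Suc n)" for xs
    using map_nth[of "tl (tl xs)"] that by (cases xs; cases "tl xs") (simp_all add: comp_def)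
qed

text \<open>Five tails suffice for \<open>rec_fun_least_cell\<close>: the search, two bounded
  quantifiers and two sums bind one variable each.\<close>

lemma rec_fun_tl_nth:
  assumes "i < n"
  shows "rec_fun (Suc n) (\<lambda>xs. tl xs ! i)"
    "rec_fun (Suc (Suc n)) (\<lambda>xs. tl (tl xs) ! i)"
    "rec_fun (Suc (Suc (Suc n))) (\<lambda>xs. tl (tl (tl xs)) ! i)"
    "rec_fun (Suc (Suc (Suc (Suc n)))) (\<lambda>xs. tl (tl (tl (tl xs))) ! i)"
    "rec_fun (Suc (Suc (Suc (Suc (Suc n))))) (\<lambda>xs. tl (tl (tl (tl (tl xs)))) ! i)"
proof -
  note 0 = rec_fun_nth[OF assms]
  show 1: "rec_fun (Suc n) (\<lambda>xs. tl xs ! i)" by (rule rec_fun_tl[OF 0])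
  show 2: "rec_fun (Suc (Suc n)) (\<lambda>xs. tl (tl xs) ! i)" by (rule rec_fun_tl[OF 1])
  show 3: "rec_fun (Suc (Suc (Suc n))) (\<lambda>xs. tl (tl (tl xs)) ! i)" by (rule rec_fun_tl[OF 2])
  show 4: "rec_fun (Suc (Suc (Suc (Suc n)))) (\<lambda>xs. tl (tl (tl (tl xs))) ! i)" by (rule rec_fun_tl[OF 3])
  show "rec_fun (Suc (Suc (Suc (Suc (Suc n))))) (\<lambda>xs. tl (tl (tl (tl (tl xs)))) ! i)" by (rule rec_fun_tl[OF 4])
qed

lemma rec_fun_Suc: "rec_fun n f \<Longrightarrow> rec_fun n (\<lambda>xs. Suc (f xs))"
proof -
  have "rec_fun 1 (\<lambda>xs. Suc (xs ! 0))"
    unfolding rec_fun_def by (rule exI[of _ Succ]) (auto simp: length_Suc_conv intro: rec_eval.Succ)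
  then show "rec_fun n f \<Longrightarrow> rec_fun n (\<lambda>xs. Suc (f xs))"
    using rec_fun_comp[of "[f]" "\<lambda>xs. Suc (xs ! 0)" n] by simp
qed

lemma rec_fun_const: "rec_fun n (\<lambda>xs. c)"
proof (induction c)
  case 0
  show ?case unfolding rec_fun_def by (auto intro: rec_eval.Zero)
qed (rule rec_fun_Suc)

text \<open>In the rules for binding operators the bound variables are prepended to the argument list, so
  inside the body they appear as \<open>ys ! 0\<close>, \<open>ys ! 1\<close> and the outer arguments as a tail of \<open>ys\<close>.\<close>

lemma rec_fun_rec_nat:
  assumes f: "rec_fun n f" and g: "rec_fun (Suc (Suc n)) (\<lambda>ys. g (ys ! 0) (ys ! 1) (tl (tl ys)))"
    and b: "rec_fun n b"
  shows "rec_fun n (\<lambda>xs. rec_nat (f xs) (\<lambda>k r. g k r xs) (b xs))"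
proof -
  obtain p where p: "\<And>xs. length xs = n \<Longrightarrow> rec_eval p xs (f xs)"
    using f by (auto simp: rec_fun_def)
  obtain q where q: "\<And>ys. length ys = Suc (Suc n) \<Longrightarrow> rec_eval q ys (g (ys ! 0) (ys ! 1) (tl (tl ys)))"
    using g by (auto simp: rec_fun_def)
  have ev: "rec_eval (PrimRec p q) (m # xs) (rec_nat (f xs) (\<lambda>k r. g k r xs) m)"
    if "length xs = n" for m xs
  proof (induction m)
    case 0
    show ?case using rec_eval.PrimRec_0[OF p[OF that]] by simp
  next
    case (Suc m)
    let ?r = "rec_nat (f xs) (\<lambda>k r. g k r xs) m"
    have "rec_eval q (m # ?r # xs) (g m ?r xs)" using q[of "m # ?r # xs"] that by simp
    from rec_eval.PrimRec_Suc[OF Suc.IH this] show ?case by simp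
  qed
  have "rec_fun (Suc n) (\<lambda>ys. rec_nat (f (tl ys)) (\<lambda>k r. g k r (tl ys)) (hd ys))"
    unfolding rec_fun_def by (rule exI[of _ "PrimRec p q"]) (auto simp: length_Suc_conv ev)
  from rec_fun_Cons[OF this b] show ?thesis by simp
qed

section \<open>Closure under arithmetic, bounded quantifiers and search\<close>

lemma rec_fun_add:
  assumes "rec_fun n f" "rec_fun n g"
  shows "rec_fun n (\<lambda>xs. f xs + g xs)"
proof -
  have "rec_nat a (\<lambda>k r. Suc r) b = a + b" for a b by (induction b) simp_all
  moreover have "rec_fun (Suc (Suc n)) (\<lambda>ys. Suc (ys ! 1))"
    by (intro rec_fun_Suc rec_fun_nth) simp
  ultimately show ?thesis
    using rec_fun_rec_nat[of n f "\<lambda>k r xs. Suc r" g] assms by simp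
qed

lemma rec_fun_mult:
  assumes "rec_fun n f" "rec_fun n g"
  shows "rec_fun n (\<lambda>xs. f xs * g xs)"
proof -
  have "rec_nat 0 (\<lambda>k r. r + a) b = a * b" for a b :: nat by (induction b) simp_all
  moreover have "rec_fun (Suc (Suc n)) (\<lambda>ys. ys ! 1 + f (tl (tl ys)))"
    by (intro rec_fun_add rec_fun_tl rec_fun_nth assms) simp
  ultimately show ?thesis
    using rec_fun_rec_nat[of n "\<lambda>_. 0" "\<lambda>k r xs. r + f xs" g] assms by (simp add: rec_fun_const)
qed

lemma rec_fun_diff:
  assumes "rec_fun n f" "rec_fun n g"
  shows "rec_fun n (\<lambda>xs. f xs - g xs)"
proof -
  have pred: "rec_fun m (\<lambda>xs. h xs - 1)" if "rec_fun m h" for m h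
  proof -
    have "rec_nat 0 (\<lambda>k r. k) b = b - 1" for b :: nat by (cases b) simp_all
    moreover have "rec_fun (Suc (Suc m)) (\<lambda>ys. ys ! 0)" by (intro rec_fun_nth) simp
    ultimately show ?thesis
      using rec_fun_rec_nat[of m "\<lambda>_. 0" "\<lambda>k r xs. k" h] that by (simp add: rec_fun_const)
  qed
  have "rec_nat a (\<lambda>k r. r - 1) b = a - b" for a b :: nat by (induction b) simp_all
  moreover have "rec_fun (Suc (Suc n)) (\<lambda>ys. ys ! 1 - 1)" by (intro pred rec_fun_nth) simp
  ultimately show ?thesis
    using rec_fun_rec_nat[of n f "\<lambda>k r xs. r - 1" g] assms by simp
qed

lemma rec_fun_power: "rec_fun n f \<Longrightarrow> rec_fun n (\<lambda>xs. f xs ^ c)"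
  by (induction c) (auto intro: rec_fun_const rec_fun_mult)

lemma rec_fun_fact:
  assumes "rec_fun n f"
  shows "rec_fun n (\<lambda>xs. fact (f xs))"
proof -
  have "rec_nat 1 (\<lambda>k r. Suc k * r) b = fact b" for b by (induction b) simp_all
  moreover have "rec_fun (Suc (Suc n)) (\<lambda>ys. Suc (ys ! 0) * ys ! 1)"
    by (intro rec_fun_mult rec_fun_Suc rec_fun_nth) simp_all
  ultimately show ?thesis
    using rec_fun_rec_nat[of n "\<lambda>_. 1" "\<lambda>k r xs. Suc k * r" f] assms by (simp add: rec_fun_const)
qed

lemma rec_fun_sum:
  assumes "rec_fun n b" "rec_fun (Suc n) (\<lambda>ys. f (ys ! 0) (tl ys))"
  shows "rec_fun n (\<lambda>xs. \<Sum>i<b xs. f i xs)"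
proof -
  have "rec_nat 0 (\<lambda>k r. r + h k) m = (\<Sum>i<m. h i)" for h :: "nat \<Rightarrow> nat" and m
    by (induction m) simp_all
  moreover have "rec_fun (Suc (Suc n)) (\<lambda>ys. ys ! 1 + f (ys ! 0) (tl (tl ys)))"
    using rec_fun_skip[OF assms(2)] by (intro rec_fun_add rec_fun_nth) simp_all
  ultimately show ?thesis
    using rec_fun_rec_nat[of n "\<lambda>_. 0" "\<lambda>k r xs. r + f k xs" b] assms by (simp add: rec_fun_const)
qed

lemma rec_fun_of_bool: "rec_pred n P \<Longrightarrow> rec_fun n (\<lambda>xs. of_bool (P xs))"
  by (simp add: rec_pred_def)

lemma rec_pred_le:
  assumes "rec_fun n f" "rec_fun n g"
  shows "rec_pred n (\<lambda>xs. f xs \<le> g xs)"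
proof -
  \<comment> \<open>Truncated subtraction makes this 1 exactly if f \<le> g, and 0
    otherwise.\<close>
  have "rec_fun n (\<lambda>xs. 1 - (f xs - g xs))"
    by (intro rec_fun_diff rec_fun_const assms)
  then show ?thesis unfolding rec_pred_def by (rule rec_fun_cong) auto
qed

lemma rec_pred_less: "rec_fun n f \<Longrightarrow> rec_fun n g \<Longrightarrow> rec_pred n (\<lambda>xs. f xs < g xs)"
  unfolding less_eq_Suc_le by (intro rec_pred_le rec_fun_Suc)

lemma rec_pred_not:
  assumes "rec_pred n P"
  shows "rec_pred n (\<lambda>xs. \<not> P xs)"
proof -
  have "rec_fun n (\<lambda>xs. 1 - of_bool (P xs))"
    by (intro rec_fun_diff rec_fun_const rec_fun_of_bool assms)
  then show ?thesis unfolding rec_pred_def by (rule rec_fun_cong) simp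
qed

lemma rec_pred_conj:
  assumes "rec_pred n P" "rec_pred n Q"
  shows "rec_pred n (\<lambda>xs. P xs \<and> Q xs)"
proof -
  have "rec_fun n (\<lambda>xs. of_bool (P xs) * of_bool (Q xs))"
    by (intro rec_fun_mult rec_fun_of_bool assms)
  then show ?thesis unfolding rec_pred_def by (rule rec_fun_cong) simp
qed

lemma rec_pred_imp:
  assumes "rec_pred n P" "rec_pred n Q"
  shows "rec_pred n (\<lambda>xs. P xs \<longrightarrow> Q xs)"
proof -
  have "rec_pred n (\<lambda>xs. \<not> (P xs \<and> \<not> Q xs))"
    by (intro rec_pred_not rec_pred_conj assms)
  then show ?thesis by simp
qed

lemma rec_pred_all:
  assumes "rec_fun n b" "rec_pred (Suc n) (\<lambda>ys. P (ys ! 0) (tl ys))"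
  shows "rec_pred n (\<lambda>xs. \<forall>i<b xs. P i xs)"
proof -
  \<comment> \<open>One minus the number of counterexamples, truncated at 0.\<close>
  have "rec_fun n (\<lambda>xs. 1 - (\<Sum>i<b xs. of_bool (\<not> P i xs)))"
    by (intro rec_fun_diff rec_fun_const rec_fun_sum rec_fun_of_bool rec_pred_not assms)
  moreover have "1 - (\<Sum>i<b xs. of_bool (\<not> P i xs)) = (of_bool (\<forall>i<b xs. P i xs) :: nat)" for xs
  proof (cases "\<forall>i<b xs. P i xs")
    case False
    then obtain i where i: "i < b xs" "\<not> P i xs" by auto
    have "of_bool (\<not> P i xs) \<le> (\<Sum>i<b xs. of_bool (\<not> P i xs) :: nat)"
      by (rule member_le_sum) (use i in auto)
    then have "1 - (\<Sum>i<b xs. of_bool (\<not> P i xs)) = (0 :: nat)"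
      using i(2) by (simp only: diff_is_0_eq of_bool_eq not_False_eq_True)
    with False show ?thesis by (simp only: of_bool_eq)
  qed simp
  ultimately show ?thesis unfolding rec_pred_def by simp
qed

lemma rec_fun_div:
  assumes "rec_fun n f" "rec_fun n g"
  shows "rec_fun n (\<lambda>xs. f xs div g xs)"
proof -
  \<comment> \<open>The quotient is the number of positive multiples of g up to f; the conjunct 0 <
    g gives 0 for division by 0, as \<open>div\<close> does.\<close>
  have "rec_fun n (\<lambda>xs. \<Sum>i<f xs. of_bool (0 < g xs \<and> Suc i * g xs \<le> f xs))"
    by (intro rec_fun_sum rec_fun_of_bool rec_pred_conj rec_pred_less rec_pred_le rec_fun_mult
        rec_fun_Suc rec_fun_const rec_fun_nth rec_fun_tl assms) simp
  moreover have "(\<Sum>i<a. of_bool (0 < b \<and> Suc i * b \<le> a)) = a div b" for a b :: nat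
  proof (cases "b > 0")
    case True
    have "i < a" if "Suc i * b \<le> a" for i
      using True mult_le_mono2[of 1 b "Suc i"] that by simp
    then have "{..<a} \<inter> {i. 0 < b \<and> Suc i * b \<le> a} = {..<a div b}"
      using True
      by (auto simp: less_eq_div_iff_mult_less_eq less_eq_Suc_le simp del: mult_Suc)
    then show ?thesis by (simp add: of_bool_def sum.If_cases del: mult_Suc)
  qed simp
  ultimately show ?thesis by simp
qed

lemma rec_fun_mod:
  assumes "rec_fun n f" "rec_fun n g"
  shows "rec_fun n (\<lambda>xs. f xs mod g xs)"
  unfolding minus_mult_div_eq_mod [symmetric]
  by (intro rec_fun_diff rec_fun_mult rec_fun_div assms)

text \<open>\<open>Mu\<close> searches for a zero, so it runs on the characteristic function of the
  negation. That function is total, and the existence hypothesis makes the search halt.\<close>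

lemma rec_fun_Least:
  assumes "rec_pred (Suc n) (\<lambda>ys. P (ys ! 0) (tl ys))"
    and "\<And>xs. length xs = n \<Longrightarrow> \<exists>y. P y xs"
  shows "rec_fun n (\<lambda>xs. LEAST y. P y xs)"
proof -
  obtain p where p: "\<And>ys. length ys = Suc n \<Longrightarrow> rec_eval p ys (of_bool (\<not> P (ys ! 0) (tl ys)))"
    using rec_pred_not[OF assms(1)] by (auto simp: rec_pred_def rec_fun_def)
  have "rec_eval (Mu p) xs (LEAST y. P y xs)" if len: "length xs = n" for xs
  proof (rule rec_eval.Mu)
    have "P (LEAST y. P y xs) xs" using assms(2)[OF len] by (rule LeastI_ex)
    then show "rec_eval p ((LEAST y. P y xs) # xs) 0"
      using p[of "(LEAST y. P y xs) # xs"] len by simp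
    show "\<exists>v. rec_eval p (i # xs) (Suc v)" if "i < (LEAST y. P y xs)" for i
      using p[of "i # xs"] len not_less_Least[OF that] by auto
  qed
  then show ?thesis unfolding rec_fun_def by blast
qed

lemmas rec_intros = rec_fun_const rec_fun_nth rec_fun_tl_nth rec_fun_Suc rec_fun_add rec_fun_mult rec_fun_diff
  rec_fun_power rec_fun_fact rec_fun_sum rec_fun_of_bool rec_fun_div rec_fun_mod
  rec_pred_le rec_pred_less rec_pred_conj rec_pred_imp rec_pred_all

text \<open>For N = j^8 and X = u / j the threshold X / N is u / W with W = j N; the remainder
  modulo W expresses the distance condition on the i-th open cell of mesh 1 / D, by
  \<open>near_int_cell_iff\<close>.\<close>

definition cell_count :: "nat \<Rightarrow> nat \<Rightarrow> nat \<Rightarrow> nat \<Rightarrow> nat" where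
  "cell_count j u i D = (\<Sum>m<Suc (j ^ 8). \<Sum>n<Suc (j ^ 8). of_bool (1 \<le> m \<and> m < n \<and>
     (i * (j * j ^ 8 * (n * n - m * m)) div D + u) mod (j * j ^ 8) < 2 * u))"

text \<open>The inequality of \<open>level_ok\<close> with denominators cleared, split in two
  because subtraction of natural numbers truncates.\<close>

definition cell_ok :: "nat \<Rightarrow> nat \<Rightarrow> nat \<Rightarrow> bool" where
  "cell_ok j i D \<longleftrightarrow> (\<forall>u<Suc (j ^ 2).
     j * cell_count j u i D \<le> u * j ^ 8 + j ^ 8 \<and> u * j ^ 8 \<le> j * cell_count j u i D + j ^ 8)"

lemma rec_fun_least_cell:
  assumes "\<And>k. \<exists>i. A * fact (k ^ 25) \<le> i \<and> (\<forall>j<Suc k. j0 \<le> j \<longrightarrow> cell_ok j i (B * fact (k ^ 25)))"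
  shows "computable (\<lambda>k. LEAST i. A * fact (k ^ 25) \<le> i
      \<and> (\<forall>j<Suc k. j0 \<le> j \<longrightarrow> cell_ok j i (B * fact (k ^ 25))))"
proof (intro computable_if_rec_fun rec_fun_Least)
  show "rec_pred (Suc 1) (\<lambda>ys. A * fact ((tl ys ! 0) ^ 25) \<le> ys ! 0
      \<and> (\<forall>j<Suc (tl ys ! 0). j0 \<le> j \<longrightarrow> cell_ok j (ys ! 0) (B * fact ((tl ys ! 0) ^ 25))))"
    unfolding cell_ok_def cell_count_def by (intro rec_intros) simp_all
qed (use assms in blast)

section \<open>The leftmost good cells\<close>

text \<open>On an open cell of the grid with mesh \<open>1 / D\<close>, where \<open>D\<close> is a multiple of \<open>W d\<close>, the number
  \<open>W d x\<close> stays strictly between two consecutive integers, so the condition on \<open>d x\<close> can be read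
  off the index of the cell.\<close>

lemma near_int_cell_iff:
  fixes x :: real and W d e i u :: nat
  assumes pos: "W > 0" "d > 0" "e > 0" and D: "D = W * d * e"
    and cell: "real i < real D * x" "real D * x < real i + 1"
  shows "dist_nearest_int (real d * x) \<le> real u / real W
    \<longleftrightarrow> (i * (W * d) div D + u) mod W < 2 * u"
proof -
  define c where "c = i * (W * d) div D"
  \<comment> \<open>The index of the cell of the coarser grid of mesh 1 / (W d) that contains the
    given cell.\<close>
  have c: "c = i div e"
    using pos by (simp add: c_def D mult.commute[of i] div_mult_mult1)
  define t where "t = real W * (real d * x)"
  have Dx: "real D * x = t * real e" by (simp add: D t_def)
  have lower: "real c < t"
  proof -
    have "real (c * e) \<le> real i" unfolding c by (simp only: of_nat_le_iff div_times_less_eq_dividend)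
    then have "real c * real e < t * real e" using cell(1) by (simp add: Dx)
    then show ?thesis using pos by simp
  qed
  have upper: "t < real c + 1"
  proof -
    have "i < (c + 1) * e" unfolding c using pos by (simp add: dividend_less_div_times)
    then have "i + 1 \<le> (c + 1) * e" by simp
    then have "real (i + 1) \<le> real ((c + 1) * e)" by (simp only: of_nat_le_iff)
    then have "t * real e < (real c + 1) * real e" using cell(2) unfolding Dx by (simp add: distrib_right)
    then show ?thesis using pos by simp
  qed
  have "dist_nearest_int (real d * x) \<le> real u / real W
      \<longleftrightarrow> (\<exists>z::int. \<bar>t - of_int (int W * z)\<bar> \<le> real u)"
  proof -
    have "\<bar>real d * x - of_int z\<bar> \<le> real u / real W \<longleftrightarrow> \<bar>t - of_int (int W * z)\<bar> \<le> real u" for z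
    proof -
      have "t - of_int (int W * z) = real W * (real d * x - of_int z)"
        by (simp add: t_def algebra_simps)
      then have "\<bar>t - of_int (int W * z)\<bar> = \<bar>real d * x - of_int z\<bar> * real W"
        by (simp add: abs_mult)
      then show ?thesis using pos by (simp add: pos_le_divide_eq)
    qed
    then show ?thesis by (simp add: dist_nearest_int_le_iff)
  qed
  \<comment> \<open>Since t lies strictly between c and c + 1, comparing t with the integers w - u
    and w + u amounts to w - u \<le> c and c < w + u; hence one strict inequality and 2 u admissible
    residues.\<close>
  also have "\<dots> \<longleftrightarrow> (\<exists>z::int. 0 \<le> int c + int u - int W * z \<and> int c + int u - int W * z < 2 * int u)"
  proof -
    have "\<bar>t - of_int w\<bar> \<le> real u \<longleftrightarrow> 0 \<le> int c + int u - w \<and> int c + int u - w < 2 * int u" for w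
      using lower upper by (simp add: abs_le_iff) linarith
    then show ?thesis by (simp only:)
  qed
  also have "\<dots> \<longleftrightarrow> (int c + int u) mod int W < 2 * int u"
  proof
    assume "\<exists>z::int. 0 \<le> int c + int u - int W * z \<and> int c + int u - int W * z < 2 * int u"
    then obtain z where z: "0 \<le> int c + int u - int W * z" "int c + int u - int W * z < 2 * int u"
      by blast
    have "(int c + int u) mod int W = (int c + int u - int W * z) mod int W"
      by (simp add: mod_diff_eq[symmetric])
    also have "\<dots> \<le> int c + int u - int W * z" using z(1) by (rule zmod_le_nonneg_dividend)
    finally show "(int c + int u) mod int W < 2 * int u" using z(2) by simp
  next
    assume "(int c + int u) mod int W < 2 * int u"
    then have "0 \<le> int c + int u - int W * ((int c + int u) div int W)
        \<and> int c + int u - int W * ((int c + int u) div int W) < 2 * int u"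
      using pos by (simp add: minus_mult_div_eq_mod)
    then show "\<exists>z::int. 0 \<le> int c + int u - int W * z \<and> int c + int u - int W * z < 2 * int u" ..
  qed
  also have "\<dots> \<longleftrightarrow> (c + u) mod W < 2 * u"
  proof -
    have "(int c + int u) mod int W = int ((c + u) mod W)" by (simp add: of_nat_mod)
    then show ?thesis by auto
  qed
  finally show ?thesis by (simp add: c_def)
qed

lemma cell_ok_iff:
  fixes x :: real
  assumes j: "0 < j" "j \<le> k" and B: "B > 0" and D: "D = B * fact (k ^ 25)"
    and cell: "real i < real D * x" "real D * x < real i + 1"
  shows "cell_ok j i D \<longleftrightarrow> level_ok j x"
proof -
  define N where "N = j ^ 8"
  have N: "N > 0" using j by (simp add: N_def)
  have count: "cell_count j u i D = real N * pair_corr x N (real u / real j)" for u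
  proof -
    let ?P = "\<lambda>p. dist_nearest_int (real (sq_diff p) * x) \<le> real u / real j / real N"
    let ?Q = "\<lambda>p. (i * (j * N * sq_diff p) div D + u) mod (j * N) < 2 * u"
    have PQ: "?P p \<longleftrightarrow> ?Q p" if p: "p \<in> ordered_pairs N" for p
    proof -
      have pos: "sq_diff p > 0" using sq_diff_pos[OF p] .
      \<comment> \<open>The origin of the exponent 25: each W d = j N d is at most j N^3 = j^25,
        hence divides the factorial of k^25.\<close>
      have "j * N * sq_diff p \<le> j * N * (N * N)" using sq_diff_le[OF p] by simp
      also have "\<dots> = j ^ 25" by (simp add: N_def flip: power_Suc power_add)
      also have "\<dots> \<le> k ^ 25" using j by (intro power_mono) auto
      finally have "j * N * sq_diff p dvd fact (k ^ 25)" using j N pos by (intro dvd_fact) auto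
      then have "j * N * sq_diff p dvd D" unfolding D by (rule dvd_mult)
      then obtain e where e: "D = j * N * sq_diff p * e" ..
      have "D > 0" using B by (simp add: D)
      then have "e > 0" using e by (cases e) auto
      from near_int_cell_iff[OF _ pos this e cell] j N show ?thesis by simp
    qed
    have "cell_count j u i D = (\<Sum>m\<in>{..<Suc N}. \<Sum>n\<in>{..<Suc N}.
        if (m, n) \<in> ordered_pairs N \<and> ?Q (m, n) then 1 else 0)"
      unfolding cell_count_def N_def [symmetric]
      by (intro sum.cong refl) (auto simp: ordered_pairs_def sq_diff_def)
    also have "\<dots> = (\<Sum>p\<in>{..<Suc N} \<times> {..<Suc N}. if p \<in> ordered_pairs N \<and> ?Q p then 1 else 0)"
      unfolding sum.cartesian_product by (intro sum.cong refl) auto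
    also have "\<dots> = card (({..<Suc N} \<times> {..<Suc N}) \<inter> {p. p \<in> ordered_pairs N \<and> ?Q p})"
      by (simp add: sum.If_cases)
    also have "({..<Suc N} \<times> {..<Suc N}) \<inter> {p. p \<in> ordered_pairs N \<and> ?Q p} = {p \<in> ordered_pairs N. ?P p}"
      using PQ by (auto simp: ordered_pairs_def)
    finally have "real (cell_count j u i D) = real (card {p \<in> ordered_pairs N. ?P p})" by simp
    also have "\<dots> = (\<Sum>p\<in>ordered_pairs N. indicator {x. dist_nearest_int (real (sq_diff p) * x) \<le> real u / real j / real N} x)"
      by (simp add: indicator_def sum.If_cases Int_def)
    also have "\<dots> = real N * pair_corr x N (real u / real j)"
      using N by (simp add: pair_corr_eq_sum)
    finally show ?thesis .
  qed
  have "j * cell_count j u i D \<le> u * N + N \<and> u * N \<le> j * cell_count j u i D + N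
      \<longleftrightarrow> \<bar>pair_corr x N (real u / real j) - real u / real j\<bar> \<le> 1 / real j" for u
  proof -
    let ?r = "pair_corr x N (real u / real j)"
    have "j * cell_count j u i D \<le> u * N + N \<longleftrightarrow> real (j * cell_count j u i D) \<le> real (u * N + N)"
      by (simp only: of_nat_le_iff)
    also have "\<dots> \<longleftrightarrow> real N * (real j * ?r) \<le> real N * (real u + 1)"
      by (simp add: count algebra_simps)
    also have "\<dots> \<longleftrightarrow> real j * ?r \<le> real u + 1" using N by simp
    also have "\<dots> \<longleftrightarrow> real j * ?r \<le> real j * (real u / real j + 1 / real j)"
      using j by (simp add: distrib_left)
    also have "\<dots> \<longleftrightarrow> ?r - real u / real j \<le> 1 / real j"
      using j by (subst mult_le_cancel_left_pos) auto
    finally have 1: "j * cell_count j u i D \<le> u * N + N \<longleftrightarrow> ?r - real u / real j \<le> 1 / real j" .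
    have "u * N \<le> j * cell_count j u i D + N \<longleftrightarrow> real (u * N) \<le> real (j * cell_count j u i D + N)"
      by (simp only: of_nat_le_iff)
    also have "\<dots> \<longleftrightarrow> real N * real u \<le> real N * (real j * ?r + 1)"
      by (simp add: count algebra_simps)
    also have "\<dots> \<longleftrightarrow> real u \<le> real j * ?r + 1" using N by simp
    also have "\<dots> \<longleftrightarrow> real j * (real u / real j) \<le> real j * (?r + 1 / real j)"
      using j by (simp add: distrib_left)
    also have "\<dots> \<longleftrightarrow> - (?r - real u / real j) \<le> 1 / real j"
      using j by (subst mult_le_cancel_left_pos) auto
    finally have 2: "u * N \<le> j * cell_count j u i D + N \<longleftrightarrow> - (?r - real u / real j) \<le> 1 / real j" .
    show ?thesis unfolding 1 2 abs_le_iff ..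
  qed
  then show ?thesis
    unfolding cell_ok_def level_ok_def N_def by (simp add: less_Suc_eq_le)
qed

section \<open>Rational intervals and the limit of the leftmost cells\<close>

lemma ex_rational_subinterval:
  fixes a b :: real
  assumes "a < b" "b > 0"
  obtains A B :: nat where "B > 0" "a \<le> real A / real B" "(real A + 1) / real B \<le> b"
proof -
  \<comment> \<open>Cutting at 0 allows a natural numerator, and b > 0 keeps the interval
    nondegenerate.\<close>
  define a' where "a' = max a 0"
  have a': "0 \<le> a'" "a \<le> a'" "a' < b" using assms by (auto simp: a'_def)
  \<comment> \<open>Room for two steps of 1 / B: one lost when A is rounded up, one for the
    subinterval.\<close>
  obtain B :: nat where B: "2 / (b - a') < real B" using reals_Archimedean2 by blast
  have "0 < 2 / (b - a')" using a' by simp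
  then have B0: "B > 0" using B by (cases B) auto
  define A where "A = nat \<lceil>a' * real B\<rceil>"
  have "0 \<le> a' * real B" using a' by simp
  then have A: "a' * real B \<le> real A" "real A \<le> a' * real B + 1"
    unfolding A_def by linarith+
  show ?thesis
  proof (rule that[OF B0])
    have "a' \<le> real A / real B" using A(1) B0 by (simp add: pos_le_divide_eq)
    then show "a \<le> real A / real B" using a' by simp
    have "2 < (b - a') * real B" using B a' by (simp add: pos_divide_less_eq mult.commute)
    then show "(real A + 1) / real B \<le> b"
      using A(2) B0 by (simp add: pos_divide_le_eq algebra_simps)
  qed
qed

text \<open>The left ends increase because a cell passing the tests of step k + 1 lies in one
  passing those of step k. The midpoints have the same limit and satisfy each level j \<ge>
  \<open>j0\<close> from step j on.\<close>

lemma ex_computable_limit: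
  fixes a b :: real
  assumes "a < b" "b > 0"
  obtains f g :: "nat \<Rightarrow> nat" and \<alpha> :: real
  where "computable f" "computable g" "\<And>k. g k > 0" "\<And>k. real (f k) / real (g k) \<in> {a..b}"
    "(\<lambda>k. real (f k) / real (g k)) \<longlonglongrightarrow> \<alpha>" "\<alpha> \<in> {a..b}" "pair_corr_converges \<alpha>"
proof -
  obtain A B :: nat where B: "B > 0" and AB: "a \<le> real A / real B" "(real A + 1) / real B \<le> b"
    using ex_rational_subinterval[OF assms] .
  obtain j0 where j0: "j0 > 0" and ex: "\<And>(A::nat) (D::nat) k. D > 0 \<Longrightarrow>
      \<exists>x. real A / real B \<le> x \<and> x < (real A + 1) / real B
        \<and> real D * x \<notin> \<int> \<and> (\<forall>j. j0 \<le> j \<longrightarrow> j \<le> k \<longrightarrow> level_ok j x)"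
    using ex_levels_ok_in_interval[OF B] by blast
  define D :: "nat \<Rightarrow> nat" where "D k = B * fact (k ^ 25)" for k
  have D: "D k > 0" for k using B by (simp add: D_def)
  define good where "good i k \<longleftrightarrow> A * fact (k ^ 25) \<le> i
    \<and> (\<forall>j<Suc k. j0 \<le> j \<longrightarrow> cell_ok j i (D k))" for i k
  have good_floor: "good (nat \<lfloor>real (D k) * x\<rfloor>) k"
    if x: "real A / real B \<le> x" "real (D k) * x \<notin> \<int>" and ok: "\<And>j. j0 \<le> j \<Longrightarrow> j \<le> k \<Longrightarrow> level_ok j x"
    for x k
  proof -
    have "real (A * fact (k ^ 25)) = real (D k) * (real A / real B)"
      using B by (simp add: D_def)
    also have "\<dots> \<le> real (D k) * x" using x(1) by (rule mult_left_mono) simp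
    finally have ge: "real (A * fact (k ^ 25)) \<le> real (D k) * x" .
    then have nn: "0 \<le> real (D k) * x" using of_nat_0_le_iff order_trans by blast
    have "real (nat \<lfloor>real (D k) * x\<rfloor>) = of_int \<lfloor>real (D k) * x\<rfloor>" using nn by simp
    moreover have "of_int \<lfloor>real (D k) * x\<rfloor> \<noteq> real (D k) * x" using x(2) by (metis Ints_of_int)
    ultimately have cell: "real (nat \<lfloor>real (D k) * x\<rfloor>) < real (D k) * x"
      "real (D k) * x < real (nat \<lfloor>real (D k) * x\<rfloor>) + 1"
      by linarith+
    have "cell_ok j (nat \<lfloor>real (D k) * x\<rfloor>) (D k)" if "j < Suc k" "j0 \<le> j" for j
      using cell_ok_iff[OF _ _ B D_def cell, of j] that j0 ok by simp
    moreover have "A * fact (k ^ 25) \<le> nat \<lfloor>real (D k) * x\<rfloor>"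
      using ge by (simp add: le_nat_floor)
    ultimately show ?thesis by (simp add: good_def)
  qed
  have ex_good: "\<exists>x. real A / real B \<le> x \<and> x < (real A + 1) / real B \<and> good (nat \<lfloor>real (D k) * x\<rfloor>) k" for k
    using ex[OF D, of A k k] good_floor by blast
  define f where "f k = (LEAST i. good i k)" for k
  have good_f: "good (f k) k" for k
    unfolding f_def using ex_good[of k] LeastI[of "\<lambda>i. good i k"] by blast
  have f_le: "f k \<le> i" if "good i k" for i k
    unfolding f_def using that by (rule Least_le)
  define q where "q k = real (f k) / real (D k)" for k
  \<comment> \<open>The midpoint is interior to the cell, as \<open>cell_ok_iff\<close> demands; the
    left end \<open>q k\<close> is a grid point.\<close>
  define x where "x k = (real (f k) + 1 / 2) / real (D k)" for k
  have Dx: "real (D k) * x k = real (f k) + 1 / 2" for k using D[of k] by (simp add: x_def)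
  have q_ge: "real A / real B \<le> q k" for k
  proof -
    have "real (A * fact (k ^ 25)) \<le> real (f k)" using good_f[of k] by (simp only: good_def of_nat_le_iff)
    then have "real (A * fact (k ^ 25)) / real (D k) \<le> q k"
      unfolding q_def by (rule divide_right_mono) simp
    then show ?thesis using B by (simp add: D_def)
  qed
  \<comment> \<open>The search has no upper bound of its own: the measure estimate provides a good
    cell meeting the interval, and the leftmost one cannot lie to its right.\<close>
  have q_le: "q k \<le> (real A + 1) / real B" for k
  proof -
    obtain y where y: "real A / real B \<le> y" "y < (real A + 1) / real B" "good (nat \<lfloor>real (D k) * y\<rfloor>) k"
      using ex_good by blast
    have "0 \<le> y" using y(1) by (rule order_trans[rotated]) simp
    then have "real (nat \<lfloor>real (D k) * y\<rfloor>) \<le> real (D k) * y" by simp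
    moreover have "real (f k) \<le> real (nat \<lfloor>real (D k) * y\<rfloor>)" using f_le[OF y(3)] by simp
    ultimately have "real (f k) \<le> y * real (D k)" by (simp add: mult.commute)
    then have "q k \<le> y" using D[of k] by (simp add: q_def pos_divide_le_eq)
    then show ?thesis using y(2) by simp
  qed
  have x_ok: "level_ok j (x k)" if "j0 \<le> j" "j \<le> k" for j k
  proof -
    have "cell_ok j (f k) (D k)" using good_f[of k] that by (simp add: good_def)
    moreover have "real (f k) < real (D k) * x k" "real (D k) * x k < real (f k) + 1"
      by (simp_all add: Dx)
    ultimately show ?thesis using cell_ok_iff[OF _ that(2) B D_def] that(1) j0 by simp
  qed
  have "q k \<le> q (Suc k)" for k
  proof -
    have "(fact (k ^ 25) :: nat) dvd fact (Suc k ^ 25)"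
      by (intro fact_dvd power_mono) simp_all
    then obtain r where "(fact (Suc k ^ 25) :: nat) = fact (k ^ 25) * r" ..
    then have r: "D (Suc k) = D k * r" by (simp add: D_def)
    have r0: "r > 0" using D[of "Suc k"] r by (cases r) auto
    have rx: "real r * (real (D k) * x (Suc k)) = real (f (Suc k)) + 1 / 2"
      using Dx[of "Suc k"] by (simp add: r mult_ac)
    \<comment> \<open>A midpoint of the finer grid is not a point of the coarser one, since
      otherwise an even number would equal an odd one.\<close>
    have "real (D k) * x (Suc k) \<notin> \<int>"
    proof
      assume "real (D k) * x (Suc k) \<in> \<int>"
      then obtain z where "real (D k) * x (Suc k) = of_int z" by (elim Ints_cases)
      with rx have "of_int (2 * (int r * z)) = (of_int (2 * int (f (Suc k)) + 1) :: real)" by simp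
      then have "2 * (int r * z) = 2 * int (f (Suc k)) + 1" by (simp only: of_int_eq_iff)
      then show False by presburger
    qed
    moreover have "q (Suc k) \<le> x (Suc k)" unfolding q_def x_def by (intro divide_right_mono) auto
    then have "real A / real B \<le> x (Suc k)" using q_ge[of "Suc k"] by linarith
    ultimately have "good (nat \<lfloor>real (D k) * x (Suc k)\<rfloor>) k"
      by (intro good_floor x_ok) auto
    from f_le[OF this] have "f k \<le> nat \<lfloor>real (D k) * x (Suc k)\<rfloor>" .
    then have "real (f k) \<le> real (nat \<lfloor>real (D k) * x (Suc k)\<rfloor>)" by (simp only: of_nat_le_iff)
    also have "\<dots> \<le> real (D k) * x (Suc k)" by (simp add: x_def)
    finally have "real r * real (f k) \<le> real r * (real (D k) * x (Suc k))"
      by (rule mult_left_mono) simp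
    \<comment> \<open>Integrality removes the 1 / 2 that the midpoint contributed.\<close>
    then have "real (r * f k) < real (f (Suc k) + 1)" by (simp add: rx)
    then have "r * f k \<le> f (Suc k)" by (simp only: of_nat_less_iff)
    then have "real (r * f k) \<le> real (f (Suc k))" by (simp only: of_nat_le_iff)
    then show ?thesis
      using D[of k] r0 by (simp add: q_def r divide_simps mult.commute)
  qed
  then have inc: "incseq q" by (rule incseq_SucI)
  obtain \<alpha> where \<alpha>: "q \<longlonglongrightarrow> \<alpha>" "\<And>k. q k \<le> \<alpha>"
    using incseq_convergent[OF inc] q_le by blast
  have "x \<longlonglongrightarrow> \<alpha>"
  proof -
    have "(\<lambda>k. q k + 1 / 2 * (1 / real (D k))) \<longlonglongrightarrow> \<alpha> + 1 / 2 * 0"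
    proof (intro tendsto_intros \<alpha>)
      show "(\<lambda>k. 1 / real (D k)) \<longlonglongrightarrow> 0"
      proof (rule tendsto_sandwich[OF _ _ tendsto_const lim_1_over_n])
        show "\<forall>\<^sub>F k in sequentially. 1 / real (D k) \<le> 1 / real k"
          using eventually_gt_at_top[of 0]
        proof eventually_elim
          case (elim k)
          have "k \<le> k ^ 25" using elim by (intro self_le_power) auto
          also have "\<dots> \<le> fact (k ^ 25)" by (rule fact_ge_self)
          also have "\<dots> \<le> D k" using B by (simp add: D_def)
          finally have "real k \<le> real (D k)" by (simp only: of_nat_le_iff)
          then show ?case using elim by (intro divide_left_mono) auto
        qed
      qed (simp add: D_def)
    qed
    moreover have "q k + 1 / 2 * (1 / real (D k)) = x k" for k
      by (simp add: q_def x_def add_divide_distrib)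
    ultimately show ?thesis by simp
  qed
  moreover have "\<forall>\<^sub>F j in sequentially. \<forall>\<^sub>F k in sequentially. level_ok j (x k)"
    using eventually_ge_at_top[of j0]
  proof eventually_elim
    case (elim j)
    show ?case using eventually_ge_at_top[of j] by eventually_elim (rule x_ok[OF elim])
  qed
  ultimately have conv: "pair_corr_converges \<alpha>" by (rule pair_corr_converges_limit)
  show ?thesis
  proof (rule that[of f D \<alpha>])
    show "computable f"
      unfolding f_def good_def D_def
      using good_f by (intro rec_fun_least_cell) (auto simp: good_def D_def)
    have "rec_fun 1 (\<lambda>xs. B * fact ((xs ! 0) ^ 25))" by (intro rec_intros) simp
    then show "computable D" unfolding D_def by (rule computable_if_rec_fun)
    show "D k > 0" for k by (rule D)
    show in_ab: "real (f k) / real (D k) \<in> {a..b}" for k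
      using q_ge[of k] q_le[of k] AB unfolding q_def by auto
    show "(\<lambda>k. real (f k) / real (D k)) \<longlonglongrightarrow> \<alpha>" using \<alpha>(1) unfolding q_def .
    then show "\<alpha> \<in> {a..b}" using in_ab by (rule closed_sequentially[OF closed_atLeastAtMost _ , rotated])
  qed (rule conv)
qed

section \<open>Reflection and density\<close>

lemma pair_corr_converges_minus: "pair_corr_converges x \<Longrightarrow> pair_corr_converges (- x)"
  by (simp add: pair_corr_converges_def pair_corr_def)

lemma computable_const: "computable (\<lambda>_. c)"
  by (rule computable_if_rec_fun) (rule rec_fun_const)

text \<open>An interval with b > 0 is handled by natural numerators and sign exponent 0; any other
  is reflected at 0, with sign exponent 1, as the pair correlation is even in \<alpha>.\<close>

lemma ex_computable_rat_seq_limit: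
  fixes a b :: real
  assumes "a < b"
  shows "\<exists>q \<alpha>. computable_rat_seq q \<and> (\<forall>k. real_of_rat (q k) \<in> {a..b})
    \<and> (\<lambda>k. real_of_rat (q k)) \<longlonglongrightarrow> \<alpha> \<and> \<alpha> \<in> {a..b} \<and> pair_corr_converges \<alpha>"
proof (cases "b > 0")
  case True
  obtain f g \<alpha> where fg: "computable f" "computable g" "\<And>k. g k > 0"
    and lim: "\<And>k. real (f k) / real (g k) \<in> {a..b}" "(\<lambda>k. real (f k) / real (g k)) \<longlonglongrightarrow> \<alpha>"
      "\<alpha> \<in> {a..b}" "pair_corr_converges \<alpha>"
    by (rule ex_computable_limit[OF assms True]; rule that; assumption)
  define q :: "nat \<Rightarrow> rat" where "q k = of_nat (f k) / of_nat (g k)" for k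
  have "real_of_rat (q k) = real (f k) / real (g k)" for k by (simp add: q_def of_rat_divide)
  moreover have "computable_rat_seq q"
    unfolding computable_rat_seq_def
    by (rule exI[of _ "\<lambda>_. 0"], rule exI[of _ f], rule exI[of _ g])
      (use fg in \<open>auto simp: q_def computable_const\<close>)
  ultimately show ?thesis using lim by (intro exI[of _ q] exI[of _ \<alpha>]) simp
next
  case False
  then have "- b < - a" "- a > 0" using assms by auto
  obtain f g \<alpha> where
    fg: "computable f" "computable g" "\<And>k. g k > 0"
    and lim: "\<And>k. real (f k) / real (g k) \<in> {- b..- a}" "(\<lambda>k. real (f k) / real (g k)) \<longlonglongrightarrow> \<alpha>"
      "\<alpha> \<in> {- b..- a}" "pair_corr_converges \<alpha>"
    by (rule ex_computable_limit[OF \<open>- b < - a\<close> \<open>- a > 0\<close>]; rule that; assumption)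
  define q :: "nat \<Rightarrow> rat" where "q k = - (of_nat (f k) / of_nat (g k))" for k
  have q: "real_of_rat (q k) = - (real (f k) / real (g k))" for k
    by (simp add: q_def of_rat_divide of_rat_minus)
  have "computable_rat_seq q"
    unfolding computable_rat_seq_def
    by (rule exI[of _ "\<lambda>_. 1"], rule exI[of _ f], rule exI[of _ g])
      (use fg in \<open>auto simp: q_def computable_const\<close>)
  moreover have "real_of_rat (q k) \<in> {a..b}" for k using lim(1)[of k] by (auto simp: q)
  moreover have "(\<lambda>k. real_of_rat (q k)) \<longlonglongrightarrow> - \<alpha>" unfolding q by (intro tendsto_minus lim(2))
  moreover have "- \<alpha> \<in> {a..b}" using lim(3) by auto
  ultimately show ?thesis using pair_corr_converges_minus[OF lim(4)] by blast
qed

theorem theorem1: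
  shows "(AE \<alpha> in lebesgue. pair_corr_converges \<alpha>) \<and>
    (\<exists>D. D \<subseteq> {\<alpha>. pair_corr_converges \<alpha>} \<and> closure D = UNIV \<and> (\<forall>\<alpha>\<in>D. constructible \<alpha>)) \<and>
    (\<forall>a b :: real. a < b \<longrightarrow>
       (\<exists>q \<alpha>. computable_rat_seq q \<and> (\<forall>k. real_of_rat (q k) \<in> {a..b}) \<and>
          (\<lambda>k. real_of_rat (q k)) \<longlonglongrightarrow> \<alpha> \<and> \<alpha> \<in> {a..b} \<and> pair_corr_converges \<alpha>))"
proof (intro conjI)
  let ?D = "{\<alpha>. pair_corr_converges \<alpha> \<and> constructible \<alpha>}"
  have "x \<in> closure ?D" for x
    unfolding closure_approachable
  proof (intro allI impI)
    fix e :: real assume "e > 0"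
    then have "x - e / 2 < x + e / 2" by simp
    from ex_computable_rat_seq_limit[OF this] obtain \<alpha> where
      "\<alpha> \<in> {x - e / 2..x + e / 2}" "pair_corr_converges \<alpha>" "constructible \<alpha>"
      unfolding constructible_def by blast
    moreover from this(1) have "dist \<alpha> x < e" using \<open>e > 0\<close> by (auto simp: dist_real_def abs_if)
    ultimately show "\<exists>y\<in>?D. dist y x < e" by blast
  qed
  then show "\<exists>D. D \<subseteq> {\<alpha>. pair_corr_converges \<alpha>} \<and> closure D = UNIV \<and> (\<forall>\<alpha>\<in>D. constructible \<alpha>)"
    by (intro exI[of _ ?D]) auto
qed (use AE_pair_corr_converges ex_computable_rat_seq_limit in auto)

end
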